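(* Let $A$ be a triassociative algebra over a field $K$. For any corepresentation $N$ of $A$, $(C_*^{\mathrm{Trias}}(A,N),d)$ is a chain complex.
   Context: All vector spaces and tensor products are over a fixed field $K$. A triassociative algebra is a vector space $A$ with three bilinear operations $\dashv,\vdash,\bot$ satisfying for all $x,y,z$: (1) $(x\dashv y)\dashv z=x\dashv(y\dashv z)$; (2) $(x\dashv y)\dashv z=x\dashv(y\vdash z)$; (3) $(x\vdash y)\dashv z=x\vdash(y\dashv z)$; (4) $(x\dashv y)\vdash z=x\vdash(y\vdash z)$; (5) $(x\vdash y)\vdash z=x\vdash(y\vdash z)$; (6) $(x\dashv y)\dashv z=x\dashv(y\,\bot\, z)$; (7) $(x\,\bot\, y)\dashv z=x\,\bot\,(y\dashv z)$; (8) $(x\dashv y)\,\bot\, z=x\,\bot\,(y\vdash z)$; (9) $(x\vdash y)\,\bot\, z=x\vdash(y\,\bot\, z)$; (10) $(x\,\bot\, y)\vdash z=x\vdash(y\vdash z)$; (11) $(x\,\bot\, y)\,\bot\, z=x\,\bot\,(y\,\bot\, z)$. The universal enveloping algebra $UA$ is the unital associative $K$-algebra obtained from the tensor algebra $T(\alpha_lA\oplus\alpha_rA\oplus\alpha_mA\oplus\beta_lA\oplus\beta_rA\oplus\beta_mA)$ on six copies of $A$ (with elements written $\alpha_l(a)$, etc.) by imposing the following $33$ relations for all $a,b\in A$: (1)-(3) $\beta_l(b)\beta_l(a)=\beta_l(a\dashv b)=\beta_l(a\,\bot\,b)=\beta_l(a\vdash b)$; (4)-(6) $\beta_l(b)\alpha_l(a)=\alpha_l(a)\beta_l(b)=\alpha_l(a)\beta_m(b)=\alpha_l(a)\beta_r(b)$;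 (7)-(9) $\alpha_l(a\dashv b)=\alpha_l(a)\alpha_l(b)=\alpha_l(a)\alpha_m(b)=\alpha_l(a)\alpha_r(b)$; (10)-(12) $\beta_r(a\vdash b)=\beta_r(b)\beta_r(a)=\beta_r(b)\beta_l(a)=\beta_r(b)\beta_m(a)$; (13)-(15) $\alpha_r(a)\beta_r(b)=\beta_r(b)\alpha_r(a)=\beta_r(b)\alpha_l(a)=\beta_r(b)\alpha_m(a)$; (16)-(18) $\alpha_r(a)\alpha_r(b)=\alpha_r(a\vdash b)=\alpha_r(a\dashv b)=\alpha_r(a\,\bot\,b)$; (19) $\beta_l(b)\beta_r(a)=\beta_r(a\dashv b)$; (20) $\beta_l(b)\alpha_r(a)=\alpha_r(a)\beta_l(b)$; (21) $\alpha_l(a\vdash b)=\alpha_r(a)\alpha_l(b)$; (22) $\beta_l(b)\beta_m(a)=\beta_m(a\dashv b)$; (23) $\beta_l(b)\alpha_m(a)=\alpha_m(a)\beta_l(b)$; (24) $\alpha_l(a\,\bot\,b)=\alpha_m(a)\alpha_l(b)$; (25) $\beta_m(b)\beta_l(a)=\beta_m(a\vdash b)$; (26) $\beta_m(b)\alpha_l(a)=\alpha_m(a)\beta_r(b)$; (27) $\alpha_m(a\dashv b)=\alpha_m(a)\alpha_r(b)$; (28) $\beta_m(b)\beta_r(a)=\beta_r(a\,\bot\,b)$; (29) $\beta_m(b)\alpha_r(a)=\alpha_r(a)\beta_m(b)$; (30) $\alpha_m(a\vdash b)=\alpha_r(a)\alpha_m(b)$; (31) $\beta_m(b)\beta_m(a)=\beta_m(a\,\bot\,b)$;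 (32) $\beta_m(b)\alpha_m(a)=\alpha_m(a)\beta_m(b)$; (33) $\alpha_m(a\,\bot\,b)=\alpha_m(a)\alpha_m(b)$. An $A$-corepresentation is a right $UA$-module. Trees. $T_n$ ($n\ge0$) is the set of planar rooted trees with $n+1$ leaves in which every internal vertex has at least $2$ incoming edges ($T_0=\{|\}$, no internal vertex); $\psi\in T_n$ has degree $|\psi|=n$; leaves are numbered $0,\dots,n$ from left to right. The grafting $\psi_0\vee\cdots\vee\psi_k$ is obtained by arranging the trees from left to right and joining their roots to a new lowest internal vertex, connected to a new root; every tree of degree $\ge1$ is uniquely of this form with $k\ge1$. A leaf is left (resp. right) oriented if it is the leftmost (resp. rightmost) incoming edge of the vertex it is attached to; otherwise it is a middle leaf. For $\psi\in T_n$, $d_i\psi\in T_{n-1}$ ($0\le i\le n$) is obtained by deleting the $i$th leaf (suppressing any vertex left with one incoming edge). For $\psi\in T_n$ and $1\le i\le n-1$, $\circ_i^\psi$ is $\dashv$, $\vdash$, or $\bot$ according as the $i$th leaf of $\psi$ is left oriented, right oriented, or a middle leaf. Chains. For an $A$-corepresentation $N$, $C_n^{\mathrm{Trias}}(A,N)=K[T_n]\otimes N\otimes A^{\otimes n}$ ($n\ge0$), and $d=\sum_{i=0}^n(-1)^id_i\colon C_n^{\mathrm{Trias}}(A,N)\to C_{n-1}^{\mathrm{Trias}}(A,N)$ for $n\ge1$, where $d_i(\psi\otimes x\otimes\mathbf a)=(d_i\psi)\otimes d_i^\psi(x\otimes\mathbf a)$ for $\psi=\psi_0\vee\cdots\vee\psi_k\in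 T_n$, $x\in N$, $\mathbf a=(a_1,\dots,a_n)\in A^{\otimes n}$, and: $d_0^\psi(x\otimes\mathbf a)=(x\cdot\gamma)\otimes(a_2,\dots,a_n)$ with $\gamma=\alpha_l(a_1)$ if $|\psi_0|=0$ and $k=1$; $\gamma=\alpha_m(a_1)$ if $|\psi_0|=0$ and $k>1$; $\gamma=\alpha_r(a_1)$ if $|\psi_0|>0$; $d_i^\psi(x\otimes\mathbf a)=x\otimes(a_1,\dots,a_i\circ_i^\psi a_{i+1},\dots,a_n)$ for $1\le i\le n-1$; $d_n^\psi(x\otimes\mathbf a)=(x\cdot\gamma)\otimes(a_1,\dots,a_{n-1})$ with $\gamma=\beta_l(a_n)$ if $|\psi_k|>0$; $\gamma=\beta_m(a_n)$ if $k>1$ and $|\psi_k|=0$; $\gamma=\beta_r(a_n)$ if $k=1$ and $|\psi_1|=0$. *)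

theory Defs
  imports
    Complex_Main
    "HOL-Algebra.Module"
    "HOL-Algebra.QuotRing"
    "HOL-Library.Poly_Mapping"
    "HOL-Library.Function_Algebras"
begin

section \<open>Vector spaces as module records\<close>

text \<open>
  The ground field is a type \<open>'k::field\<close>, turned into a record by \<open>type_ring\<close>. Spaces
  that are quotients, or that depend on a natural number, are HOL-Algebra \<open>module\<close> records
  over it. The fields \<open>mult\<close> and \<open>one\<close>, which such a record inherits from \<open>ring\<close>, play no role
  for modules and are left undefined.
\<close>

definition type_ring :: "'r::ring_1 ring" where
  "type_ring = \<lparr>carrier = UNIV, mult = (*), one = 1, zero = 0, add = (+)\<rparr>"

definition type_module :: "('k \<Rightarrow> 'v \<Rightarrow> 'v) \<Rightarrow> ('k::field, 'v::ab_group_add) module" where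
  "type_module scale =
    \<lparr>carrier = UNIV, mult = undefined, one = undefined, zero = 0, add = (+), smult = scale\<rparr>"

definition free_module :: "'b set \<Rightarrow> ('k::field, 'b \<Rightarrow>\<^sub>0 'k) module" where
  "free_module S =
    \<lparr>carrier = {f. Poly_Mapping.keys f \<subseteq> S}, mult = undefined, one = undefined,
     zero = 0, add = (+), smult = (\<lambda>c. Poly_Mapping.map ((*) c))\<rparr>"

definition gen_submodule :: "('k::field, 'v) module \<Rightarrow> 'v set \<Rightarrow> 'v set" where
  "gen_submodule M S = \<Inter>{H. submodule H type_ring M \<and> S \<subseteq> H}"

text \<open>The analogue for modules of \<^const>\<open>FactRing\<close>.\<close>

definition quot_module :: "('k::field, 'v) module \<Rightarrow> 'v set \<Rightarrow> ('k, 'v set) module" where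
  "quot_module M H =
    \<lparr>carrier = a_rcosets\<^bsub>M\<^esub> H, mult = undefined, one = undefined,
     zero = H, add = set_add M, smult = (\<lambda>c X. \<Union>x\<in>X. H +>\<^bsub>M\<^esub> (c \<odot>\<^bsub>M\<^esub> x))\<rparr>"

definition linear_map :: "('k::field, 'v) module \<Rightarrow> ('k, 'w) module \<Rightarrow> ('v \<Rightarrow> 'w) \<Rightarrow> bool" where
  "linear_map V W f \<longleftrightarrow>
     f \<in> carrier V \<rightarrow> carrier W \<and>
     (\<forall>x\<in>carrier V. \<forall>y\<in>carrier V. f (x \<oplus>\<^bsub>V\<^esub> y) = f x \<oplus>\<^bsub>W\<^esub> f y) \<and>
     (\<forall>c. \<forall>x\<in>carrier V. f (c \<odot>\<^bsub>V\<^esub> x) = c \<odot>\<^bsub>W\<^esub> f x)"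

text \<open>Complexes concentrated in degrees \<open>\<ge> 0\<close>; \<open>d n\<close> goes from \<open>C n\<close> to \<open>C (n - 1)\<close> for \<open>n \<ge> 1\<close>,
  and \<open>d 0\<close> is not constrained.\<close>

definition chain_complex :: "(nat \<Rightarrow> ('k::field, 'v) module) \<Rightarrow> (nat \<Rightarrow> 'v \<Rightarrow> 'v) \<Rightarrow> bool" where
  "chain_complex C d \<longleftrightarrow>
     (\<forall>n. module (type_ring :: 'k ring) (C n)) \<and>
     (\<forall>n\<ge>1. linear_map (C n) (C (n - 1)) (d n)) \<and>
     (\<forall>n\<ge>2. \<forall>x\<in>carrier (C n). d (n - 1) (d n x) = \<zero>\<^bsub>C (n - 2)\<^esub>)"


section \<open>Tensor products\<close>

definition tensor_rels ::
  "('k::field, 'v) module \<Rightarrow> ('k, 'w) module \<Rightarrow> ('v \<times> 'w \<Rightarrow>\<^sub>0 'k) set" where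
  "tensor_rels V W =
     {Poly_Mapping.single (v \<oplus>\<^bsub>V\<^esub> v', w) 1
        - Poly_Mapping.single (v, w) 1 - Poly_Mapping.single (v', w) 1 | v v' w.
        v \<in> carrier V \<and> v' \<in> carrier V \<and> w \<in> carrier W} \<union>
     {Poly_Mapping.single (v, w \<oplus>\<^bsub>W\<^esub> w') 1
        - Poly_Mapping.single (v, w) 1 - Poly_Mapping.single (v, w') 1 | v w w'.
        v \<in> carrier V \<and> w \<in> carrier W \<and> w' \<in> carrier W} \<union>
     {Poly_Mapping.single (c \<odot>\<^bsub>V\<^esub> v, w) 1 - Poly_Mapping.single (v, w) c | c v w.
        v \<in> carrier V \<and> w \<in> carrier W} \<union>
     {Poly_Mapping.single (v, c \<odot>\<^bsub>W\<^esub> w) 1 - Poly_Mapping.single (v, w) c | c v w.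
        v \<in> carrier V \<and> w \<in> carrier W}"

definition tensor_null ::
  "('k::field, 'v) module \<Rightarrow> ('k, 'w) module \<Rightarrow> ('v \<times> 'w \<Rightarrow>\<^sub>0 'k) set" where
  "tensor_null V W = gen_submodule (free_module (carrier V \<times> carrier W)) (tensor_rels V W)"

definition tensor ::
  "('k::field, 'v) module \<Rightarrow> ('k, 'w) module \<Rightarrow> ('k, ('v \<times> 'w \<Rightarrow>\<^sub>0 'k) set) module" where
  "tensor V W = quot_module (free_module (carrier V \<times> carrier W)) (tensor_null V W)"

definition pure_tensor ::
  "('k::field, 'v) module \<Rightarrow> ('k, 'w) module \<Rightarrow> 'v \<Rightarrow> 'w \<Rightarrow> ('v \<times> 'w \<Rightarrow>\<^sub>0 'k) set" where
  "pure_tensor V W v w =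
     tensor_null V W +>\<^bsub>free_module (carrier V \<times> carrier W) :: ('k, _) module\<^esub>
       Poly_Mapping.single (v, w) 1"

text \<open>
  The \<open>n\<close>-fold tensor power, generated by the lists of length \<open>n\<close>. For \<open>n = 0\<close> there are no
  relations, and it is the one-dimensional space on the empty list.
\<close>

definition tuples :: "('k::field, 'v) module \<Rightarrow> nat \<Rightarrow> 'v list set" where
  "tuples V n = {a. length a = n \<and> set a \<subseteq> carrier V}"

definition tensor_power_rels :: "('k::field, 'v) module \<Rightarrow> nat \<Rightarrow> ('v list \<Rightarrow>\<^sub>0 'k) set" where
  "tensor_power_rels V n =
     {Poly_Mapping.single (a[i := v \<oplus>\<^bsub>V\<^esub> v']) 1
        - Poly_Mapping.single (a[i := v]) 1 - Poly_Mapping.single (a[i := v']) 1 | a i v v'.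
        a \<in> tuples V n \<and> i < n \<and> v \<in> carrier V \<and> v' \<in> carrier V} \<union>
     {Poly_Mapping.single (a[i := c \<odot>\<^bsub>V\<^esub> v]) 1 - Poly_Mapping.single (a[i := v]) c | a i c v.
        a \<in> tuples V n \<and> i < n \<and> v \<in> carrier V}"

definition tensor_power_null :: "('k::field, 'v) module \<Rightarrow> nat \<Rightarrow> ('v list \<Rightarrow>\<^sub>0 'k) set" where
  "tensor_power_null V n = gen_submodule (free_module (tuples V n)) (tensor_power_rels V n)"

definition tensor_power ::
  "('k::field, 'v) module \<Rightarrow> nat \<Rightarrow> ('k, ('v list \<Rightarrow>\<^sub>0 'k) set) module" where
  "tensor_power V n = quot_module (free_module (tuples V n)) (tensor_power_null V n)"

definition pure_power :: "('k::field, 'v) module \<Rightarrow> nat \<Rightarrow> 'v list \<Rightarrow> ('v list \<Rightarrow>\<^sub>0 'k) set" where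
  "pure_power V n a =
     tensor_power_null V n +>\<^bsub>free_module (tuples V n) :: ('k, _) module\<^esub>
       Poly_Mapping.single a 1"


section \<open>The tensor algebra\<close>

text \<open>
  With lists as the free monoid, the type \<open>'v list \<Rightarrow>\<^sub>0 'k\<close> with its convolution product is the
  free associative unital \<open>'k\<close>-algebra on the set \<open>'v\<close>. The tensor algebra of the vector
  space \<open>'v\<close> is its quotient by the relations making \<open>'v \<rightarrow> T('v)\<close> linear.
\<close>

instantiation list :: (type) monoid_add
begin

definition zero_list :: "'a list" where
  "zero_list = []"

definition plus_list :: "'a list \<Rightarrow> 'a list \<Rightarrow> 'a list" where
  "plus_list = (@)"

instance
  by standard (simp_all add: zero_list_def plus_list_def)

end

definition tensor_algebra_ideal ::
  "('k::field \<Rightarrow> 'v::ab_group_add \<Rightarrow> 'v) \<Rightarrow> ('v list \<Rightarrow>\<^sub>0 'k) set" where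
  "tensor_algebra_ideal scale =
     Idl\<^bsub>type_ring\<^esub>
       ({Poly_Mapping.single [v + w] 1
           - Poly_Mapping.single [v] 1 - Poly_Mapping.single [w] 1 | v w. True} \<union>
        {Poly_Mapping.single [scale c v] 1 - Poly_Mapping.single [v] c | c v. True})"

definition tensor_algebra ::
  "('k::field \<Rightarrow> 'v::ab_group_add \<Rightarrow> 'v) \<Rightarrow> ('v list \<Rightarrow>\<^sub>0 'k) set ring" where
  "tensor_algebra scale = type_ring Quot tensor_algebra_ideal scale"

definition tensor_algebra_incl ::
  "('k::field \<Rightarrow> 'v::ab_group_add \<Rightarrow> 'v) \<Rightarrow> 'v \<Rightarrow> ('v list \<Rightarrow>\<^sub>0 'k) set" where
  "tensor_algebra_incl scale v =
     tensor_algebra_ideal scale +>\<^bsub>type_ring\<^esub> Poly_Mapping.single [v] 1"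

definition tensor_algebra_const ::
  "('k::field \<Rightarrow> 'v::ab_group_add \<Rightarrow> 'v) \<Rightarrow> 'k \<Rightarrow> ('v list \<Rightarrow>\<^sub>0 'k) set" where
  "tensor_algebra_const scale c =
     tensor_algebra_ideal scale +>\<^bsub>type_ring\<^esub> Poly_Mapping.single [] c"


section \<open>Triassociative algebras and their universal enveloping algebras\<close>

text \<open>The six copies of \<open>A\<close>. As there are finitely many, their direct sum is the space of all
  functions \<open>copy \<Rightarrow> 'a\<close>.\<close>

datatype copy = AlphaL | AlphaR | AlphaM | BetaL | BetaR | BetaM

locale triassociative_algebra = vector_space scale
  for scale :: "'k::field \<Rightarrow> 'a::ab_group_add \<Rightarrow> 'a" +
  fixes lprod :: "'a \<Rightarrow> 'a \<Rightarrow> 'a" (infixl \<open>\<stileturn>\<close> 70)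
    and rprod :: "'a \<Rightarrow> 'a \<Rightarrow> 'a" (infixl \<open>\<turnstile>\<close> 70)
    and mprod :: "'a \<Rightarrow> 'a \<Rightarrow> 'a" (infixl \<open>\<bottom>\<close> 70)
  assumes lprod_linear_left: "Vector_Spaces.linear scale scale (\<lambda>x. x \<stileturn> y)"
    and lprod_linear_right: "Vector_Spaces.linear scale scale (\<lambda>y. x \<stileturn> y)"
    and rprod_linear_left: "Vector_Spaces.linear scale scale (\<lambda>x. x \<turnstile> y)"
    and rprod_linear_right: "Vector_Spaces.linear scale scale (\<lambda>y. x \<turnstile> y)"
    and mprod_linear_left: "Vector_Spaces.linear scale scale (\<lambda>x. x \<bottom> y)"
    and mprod_linear_right: "Vector_Spaces.linear scale scale (\<lambda>y. x \<bottom> y)"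
    and trias1: "(x \<stileturn> y) \<stileturn> z = x \<stileturn> (y \<stileturn> z)"
    and trias2: "(x \<stileturn> y) \<stileturn> z = x \<stileturn> (y \<turnstile> z)"
    and trias3: "(x \<turnstile> y) \<stileturn> z = x \<turnstile> (y \<stileturn> z)"
    and trias4: "(x \<stileturn> y) \<turnstile> z = x \<turnstile> (y \<turnstile> z)"
    and trias5: "(x \<turnstile> y) \<turnstile> z = x \<turnstile> (y \<turnstile> z)"
    and trias6: "(x \<stileturn> y) \<stileturn> z = x \<stileturn> (y \<bottom> z)"
    and trias7: "(x \<bottom> y) \<stileturn> z = x \<bottom> (y \<stileturn> z)"
    and trias8: "(x \<stileturn> y) \<bottom> z = x \<bottom> (y \<turnstile> z)"
    and trias9: "(x \<turnstile> y) \<bottom> z = x \<turnstile> (y \<bottom> z)"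
    and trias10: "(x \<bottom> y) \<turnstile> z = x \<turnstile> (y \<turnstile> z)"
    and trias11: "(x \<bottom> y) \<bottom> z = x \<bottom> (y \<bottom> z)"
begin

definition sum_scale :: "'k \<Rightarrow> (copy \<Rightarrow> 'a) \<Rightarrow> (copy \<Rightarrow> 'a)" where
  "sum_scale c f = (\<lambda>s. scale c (f s))"

definition TA :: "((copy \<Rightarrow> 'a) list \<Rightarrow>\<^sub>0 'k) set ring" where
  "TA = tensor_algebra sum_scale"

definition TA_gen :: "copy \<Rightarrow> 'a \<Rightarrow> ((copy \<Rightarrow> 'a) list \<Rightarrow>\<^sub>0 'k) set" where
  "TA_gen s a = tensor_algebra_incl sum_scale (\<lambda>s'. if s' = s then a else 0)"

abbreviation (input) "\<alpha>l \<equiv> TA_gen AlphaL"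
abbreviation (input) "\<alpha>r \<equiv> TA_gen AlphaR"
abbreviation (input) "\<alpha>m \<equiv> TA_gen AlphaM"
abbreviation (input) "\<beta>l \<equiv> TA_gen BetaL"
abbreviation (input) "\<beta>r \<equiv> TA_gen BetaR"
abbreviation (input) "\<beta>m \<equiv> TA_gen BetaM"

inductive UA_rel ::
  "((copy \<Rightarrow> 'a) list \<Rightarrow>\<^sub>0 'k) set \<Rightarrow> ((copy \<Rightarrow> 'a) list \<Rightarrow>\<^sub>0 'k) set \<Rightarrow> bool" where
  r1: "UA_rel (\<beta>l b \<otimes>\<^bsub>TA\<^esub> \<beta>l a) (\<beta>l (a \<stileturn> b))"
| r2: "UA_rel (\<beta>l (a \<stileturn> b)) (\<beta>l (a \<bottom> b))"
| r3: "UA_rel (\<beta>l (a \<bottom> b)) (\<beta>l (a \<turnstile> b))"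
| r4: "UA_rel (\<beta>l b \<otimes>\<^bsub>TA\<^esub> \<alpha>l a) (\<alpha>l a \<otimes>\<^bsub>TA\<^esub> \<beta>l b)"
| r5: "UA_rel (\<alpha>l a \<otimes>\<^bsub>TA\<^esub> \<beta>l b) (\<alpha>l a \<otimes>\<^bsub>TA\<^esub> \<beta>m b)"
| r6: "UA_rel (\<alpha>l a \<otimes>\<^bsub>TA\<^esub> \<beta>m b) (\<alpha>l a \<otimes>\<^bsub>TA\<^esub> \<beta>r b)"
| r7: "UA_rel (\<alpha>l (a \<stileturn> b)) (\<alpha>l a \<otimes>\<^bsub>TA\<^esub> \<alpha>l b)"
| r8: "UA_rel (\<alpha>l a \<otimes>\<^bsub>TA\<^esub> \<alpha>l b) (\<alpha>l a \<otimes>\<^bsub>TA\<^esub> \<alpha>m b)"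
| r9: "UA_rel (\<alpha>l a \<otimes>\<^bsub>TA\<^esub> \<alpha>m b) (\<alpha>l a \<otimes>\<^bsub>TA\<^esub> \<alpha>r b)"
| r10: "UA_rel (\<beta>r (a \<turnstile> b)) (\<beta>r b \<otimes>\<^bsub>TA\<^esub> \<beta>r a)"
| r11: "UA_rel (\<beta>r b \<otimes>\<^bsub>TA\<^esub> \<beta>r a) (\<beta>r b \<otimes>\<^bsub>TA\<^esub> \<beta>l a)"
| r12: "UA_rel (\<beta>r b \<otimes>\<^bsub>TA\<^esub> \<beta>l a) (\<beta>r b \<otimes>\<^bsub>TA\<^esub> \<beta>m a)"
| r13: "UA_rel (\<alpha>r a \<otimes>\<^bsub>TA\<^esub> \<beta>r b) (\<beta>r b \<otimes>\<^bsub>TA\<^esub> \<alpha>r a)"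
| r14: "UA_rel (\<beta>r b \<otimes>\<^bsub>TA\<^esub> \<alpha>r a) (\<beta>r b \<otimes>\<^bsub>TA\<^esub> \<alpha>l a)"
| r15: "UA_rel (\<beta>r b \<otimes>\<^bsub>TA\<^esub> \<alpha>l a) (\<beta>r b \<otimes>\<^bsub>TA\<^esub> \<alpha>m a)"
| r16: "UA_rel (\<alpha>r a \<otimes>\<^bsub>TA\<^esub> \<alpha>r b) (\<alpha>r (a \<turnstile> b))"
| r17: "UA_rel (\<alpha>r (a \<turnstile> b)) (\<alpha>r (a \<stileturn> b))"
| r18: "UA_rel (\<alpha>r (a \<stileturn> b)) (\<alpha>r (a \<bottom> b))"
| r19: "UA_rel (\<beta>l b \<otimes>\<^bsub>TA\<^esub> \<beta>r a) (\<beta>r (a \<stileturn> b))"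
| r20: "UA_rel (\<beta>l b \<otimes>\<^bsub>TA\<^esub> \<alpha>r a) (\<alpha>r a \<otimes>\<^bsub>TA\<^esub> \<beta>l b)"
| r21: "UA_rel (\<alpha>l (a \<turnstile> b)) (\<alpha>r a \<otimes>\<^bsub>TA\<^esub> \<alpha>l b)"
| r22: "UA_rel (\<beta>l b \<otimes>\<^bsub>TA\<^esub> \<beta>m a) (\<beta>m (a \<stileturn> b))"
| r23: "UA_rel (\<beta>l b \<otimes>\<^bsub>TA\<^esub> \<alpha>m a) (\<alpha>m a \<otimes>\<^bsub>TA\<^esub> \<beta>l b)"
| r24: "UA_rel (\<alpha>l (a \<bottom> b)) (\<alpha>m a \<otimes>\<^bsub>TA\<^esub> \<alpha>l b)"
| r25: "UA_rel (\<beta>m b \<otimes>\<^bsub>TA\<^esub> \<beta>l a) (\<beta>m (a \<turnstile> b))"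
| r26: "UA_rel (\<beta>m b \<otimes>\<^bsub>TA\<^esub> \<alpha>l a) (\<alpha>m a \<otimes>\<^bsub>TA\<^esub> \<beta>r b)"
| r27: "UA_rel (\<alpha>m (a \<stileturn> b)) (\<alpha>m a \<otimes>\<^bsub>TA\<^esub> \<alpha>r b)"
| r28: "UA_rel (\<beta>m b \<otimes>\<^bsub>TA\<^esub> \<beta>r a) (\<beta>r (a \<bottom> b))"
| r29: "UA_rel (\<beta>m b \<otimes>\<^bsub>TA\<^esub> \<alpha>r a) (\<alpha>r a \<otimes>\<^bsub>TA\<^esub> \<beta>m b)"
| r30: "UA_rel (\<alpha>m (a \<turnstile> b)) (\<alpha>r a \<otimes>\<^bsub>TA\<^esub> \<alpha>m b)"
| r31: "UA_rel (\<beta>m b \<otimes>\<^bsub>TA\<^esub> \<beta>m a) (\<beta>m (a \<bottom> b))"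
| r32: "UA_rel (\<beta>m b \<otimes>\<^bsub>TA\<^esub> \<alpha>m a) (\<alpha>m a \<otimes>\<^bsub>TA\<^esub> \<beta>m b)"
| r33: "UA_rel (\<alpha>m (a \<bottom> b)) (\<alpha>m a \<otimes>\<^bsub>TA\<^esub> \<alpha>m b)"

definition UA_ideal :: "((copy \<Rightarrow> 'a) list \<Rightarrow>\<^sub>0 'k) set set" where
  "UA_ideal = Idl\<^bsub>TA\<^esub> {u \<ominus>\<^bsub>TA\<^esub> v | u v. UA_rel u v}"

definition UA :: "((copy \<Rightarrow> 'a) list \<Rightarrow>\<^sub>0 'k) set set ring" where
  "UA = TA Quot UA_ideal"

definition UA_gen :: "copy \<Rightarrow> 'a \<Rightarrow> ((copy \<Rightarrow> 'a) list \<Rightarrow>\<^sub>0 'k) set set" where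
  "UA_gen s a = UA_ideal +>\<^bsub>TA\<^esub> TA_gen s a"

definition UA_const :: "'k \<Rightarrow> ((copy \<Rightarrow> 'a) list \<Rightarrow>\<^sub>0 'k) set set" where
  "UA_const c = UA_ideal +>\<^bsub>TA\<^esub> tensor_algebra_const sum_scale c"

end

locale right_module =
  fixes R :: "('r, 'm) ring_scheme" (structure)
    and act :: "'n::ab_group_add \<Rightarrow> 'r \<Rightarrow> 'n"
  assumes act_add_left: "r \<in> carrier R \<Longrightarrow> act (x + y) r = act x r + act y r"
    and act_add_right:
      "r \<in> carrier R \<Longrightarrow> s \<in> carrier R \<Longrightarrow> act x (r \<oplus> s) = act x r + act x s"
    and act_mult: "r \<in> carrier R \<Longrightarrow> s \<in> carrier R \<Longrightarrow> act x (r \<otimes> s) = act (act x r) s"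
    and act_one: "act x \<one> = x"


section \<open>Planar trees\<close>

text \<open>A tree is the leaf or the grafting of a list of trees; \<open>proper\<close> demands that every internal
  vertex has at least two incoming edges.\<close>

datatype ptree = Leaf | Node "ptree list"

fun proper :: "ptree \<Rightarrow> bool" where
  "proper Leaf \<longleftrightarrow> True"
| "proper (Node ts) \<longleftrightarrow> length ts \<ge> 2 \<and> (\<forall>t\<in>set ts. proper t)"

fun num_leaves :: "ptree \<Rightarrow> nat" where
  "num_leaves Leaf = 1"
| "num_leaves (Node ts) = sum_list (map num_leaves ts)"

definition tree_deg :: "ptree \<Rightarrow> nat" where
  "tree_deg t = num_leaves t - 1"

definition trees :: "nat \<Rightarrow> ptree set" where
  "trees n = {t. proper t \<and> num_leaves t = n + 1}"

text \<open>A vertex left with one incoming edge is suppressed.\<close>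

fun join :: "ptree list \<Rightarrow> ptree" where
  "join [t] = t"
| "join ts = Node ts"

fun delete_forest :: "nat \<Rightarrow> ptree list \<Rightarrow> ptree list" where
  "delete_forest i [] = []"
| "delete_forest i (Leaf # ts) = (if i = 0 then ts else Leaf # delete_forest (i - 1) ts)"
| "delete_forest i (Node us # ts) =
    (if i < num_leaves (Node us) then join (delete_forest i us) # ts
     else Node us # delete_forest (i - num_leaves (Node us)) ts)"

text \<open>Deleting the only leaf of the degree 0 tree is not meaningful; the value is arbitrary.\<close>

fun delete_leaf :: "nat \<Rightarrow> ptree \<Rightarrow> ptree" where
  "delete_leaf i Leaf = Leaf"
| "delete_leaf i (Node ts) = join (delete_forest i ts)"

datatype orientation = LeftOriented | RightOriented | Middle

text \<open>The flag says whether the forest contains the leftmost incoming edge of the vertex at which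
  it is attached. The forest always contains the rightmost one.\<close>

fun orient_forest :: "bool \<Rightarrow> nat \<Rightarrow> ptree list \<Rightarrow> orientation" where
  "orient_forest leftmost i [] = Middle"
| "orient_forest leftmost i (Leaf # ts) =
    (if i = 0 then (if leftmost then LeftOriented else if ts = [] then RightOriented else Middle)
     else orient_forest False (i - 1) ts)"
| "orient_forest leftmost i (Node us # ts) =
    (if i < num_leaves (Node us) then orient_forest True i us
     else orient_forest False (i - num_leaves (Node us)) ts)"

fun orient :: "nat \<Rightarrow> ptree \<Rightarrow> orientation" where
  "orient i Leaf = Middle"
| "orient i (Node ts) = orient_forest True i ts"

text \<open>For a grafting of \<open>k + 1\<close> trees, the condition \<open>k = 1\<close> reads \<open>length ts = 2\<close>.\<close>

fun first_copy :: "ptree \<Rightarrow> copy" where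
  "first_copy Leaf = AlphaL"
| "first_copy (Node ts) =
    (if tree_deg (hd ts) > 0 then AlphaR else if length ts = 2 then AlphaL else AlphaM)"

fun last_copy :: "ptree \<Rightarrow> copy" where
  "last_copy Leaf = BetaR"
| "last_copy (Node ts) =
    (if tree_deg (last ts) > 0 then BetaL else if length ts = 2 then BetaR else BetaM)"


section \<open>The chain complex\<close>

locale trias_corepresentation =
  triassociative_algebra scale lprod rprod mprod +
  right_module "triassociative_algebra.UA scale lprod rprod mprod" act
  for scale :: "'k::field \<Rightarrow> 'a::ab_group_add \<Rightarrow> 'a"
    and lprod :: "'a \<Rightarrow> 'a \<Rightarrow> 'a" (infixl \<open>\<stileturn>\<close> 70)
    and rprod :: "'a \<Rightarrow> 'a \<Rightarrow> 'a" (infixl \<open>\<turnstile>\<close> 70)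
    and mprod :: "'a \<Rightarrow> 'a \<Rightarrow> 'a" (infixl \<open>\<bottom>\<close> 70)
    and act :: "'n::ab_group_add \<Rightarrow> ((copy \<Rightarrow> 'a) list \<Rightarrow>\<^sub>0 'k) set set \<Rightarrow> 'n"
begin

text \<open>The vector space underlying \<open>N\<close>, by restriction of scalars along \<open>K \<rightarrow> UA\<close>.\<close>

definition N_space :: "('k, 'n) module" where
  "N_space = type_module (\<lambda>c x. act x (UA_const c))"

definition A_power :: "nat \<Rightarrow> ('k, ('a list \<Rightarrow>\<^sub>0 'k) set) module" where
  "A_power n = tensor_power (type_module scale) n"

definition chains ::
  "nat \<Rightarrow> ('k, ((ptree \<Rightarrow>\<^sub>0 'k) \<times> ('n \<times> ('a list \<Rightarrow>\<^sub>0 'k) set \<Rightarrow>\<^sub>0 'k) set \<Rightarrow>\<^sub>0 'k) set) module" where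
  "chains n = tensor (free_module (trees n)) (tensor N_space (A_power n))"

text \<open>The generator \<open>\<psi> \<otimes> x \<otimes> (a\<^sub>1, \<dots>, a\<^sub>n)\<close>.\<close>

definition chain ::
  "nat \<Rightarrow> ptree \<Rightarrow> 'n \<times> 'a list \<Rightarrow>
    ((ptree \<Rightarrow>\<^sub>0 'k) \<times> ('n \<times> ('a list \<Rightarrow>\<^sub>0 'k) set \<Rightarrow>\<^sub>0 'k) set \<Rightarrow>\<^sub>0 'k) set" where
  "chain n \<psi> = (\<lambda>(x, a).
     pure_tensor (free_module (trees n)) (tensor N_space (A_power n))
       (Poly_Mapping.single \<psi> 1)
       (pure_tensor N_space (A_power n) x (pure_power (type_module scale) n a)))"

definition leaf_prod :: "ptree \<Rightarrow> nat \<Rightarrow> 'a \<Rightarrow> 'a \<Rightarrow> 'a" where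
  "leaf_prod \<psi> i = (case orient i \<psi> of
      LeftOriented \<Rightarrow> (\<stileturn>) | RightOriented \<Rightarrow> (\<turnstile>) | Middle \<Rightarrow> (\<bottom>))"

text \<open>\<open>d\<^sub>i\<^sup>\<psi>\<close> on \<open>x \<otimes> a\<close>, for \<open>i \<le> length a\<close>. Lists count from 0, so the factor \<open>a\<^sub>i\<close> is \<open>a ! (i - 1)\<close>.\<close>

definition tree_face :: "ptree \<Rightarrow> nat \<Rightarrow> 'n \<times> 'a list \<Rightarrow> 'n \<times> 'a list" where
  "tree_face \<psi> i = (\<lambda>(x, a).
     if i = 0 then (act x (UA_gen (first_copy \<psi>) (hd a)), tl a)
     else if i < length a then
       (x, take (i - 1) a @ leaf_prod \<psi> i (a ! (i - 1)) (a ! i) # drop (i + 1) a)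
     else (act x (UA_gen (last_copy \<psi>) (last a)), butlast a))"

text \<open>The face map \<open>d\<^sub>i\<close> is the linear map with the prescribed values on the generators.
  Membership in \<^const>\<open>extensional\<close> only fixes its values outside the carrier.\<close>

definition face ::
  "nat \<Rightarrow> nat \<Rightarrow> ((ptree \<Rightarrow>\<^sub>0 'k) \<times> ('n \<times> ('a list \<Rightarrow>\<^sub>0 'k) set \<Rightarrow>\<^sub>0 'k) set \<Rightarrow>\<^sub>0 'k) set \<Rightarrow>
    ((ptree \<Rightarrow>\<^sub>0 'k) \<times> ('n \<times> ('a list \<Rightarrow>\<^sub>0 'k) set \<Rightarrow>\<^sub>0 'k) set \<Rightarrow>\<^sub>0 'k) set" where
  "face n i = (THE f.
     linear_map (chains n) (chains (n - 1)) f \<and> f \<in> extensional (carrier (chains n)) \<and>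
     (\<forall>\<psi>\<in>trees n. \<forall>x a. length a = n \<longrightarrow>
        f (chain n \<psi> (x, a)) = chain (n - 1) (delete_leaf i \<psi>) (tree_face \<psi> i (x, a))))"

definition differential ::
  "nat \<Rightarrow> ((ptree \<Rightarrow>\<^sub>0 'k) \<times> ('n \<times> ('a list \<Rightarrow>\<^sub>0 'k) set \<Rightarrow>\<^sub>0 'k) set \<Rightarrow>\<^sub>0 'k) set \<Rightarrow>
    ((ptree \<Rightarrow>\<^sub>0 'k) \<times> ('n \<times> ('a list \<Rightarrow>\<^sub>0 'k) set \<Rightarrow>\<^sub>0 'k) set \<Rightarrow>\<^sub>0 'k) set" where
  "differential n X =
     (\<Oplus>\<^bsub>chains (n - 1)\<^esub> i\<in>{0..n}. (- 1) ^ i \<odot>\<^bsub>chains (n - 1)\<^esub> face n i X)"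

end

end

theory Submission
  imports Defs
begin

text \<open>
  Label the gaps between consecutive leaves of a tree by the heights of the vertices where these
  leaves meet. The labels determine the tree, leaf \<open>i\<close> is left, right or middle oriented according
  as gap \<open>i\<close> is lower than, higher than or level with gap \<open>i + 1\<close>, and deleting leaf \<open>i\<close> replaces
  these two labels by their minimum. The eleven axioms say exactly that
  \<open>(p, a) \<cdot> (q, b) = (min p q, a \<star> b)\<close>, with \<open>\<star>\<close> one of the three products chosen by comparing \<open>p\<close>
  and \<open>q\<close>, is associative, and the copy of \<open>A\<close> through which an outer face acts is determined by
  comparing the outermost label with the others. On labelled words the simplicial
  identities \<open>d\<^sub>i d\<^sub>j = d\<^sub>j\<^sub>-\<^sub>1 d\<^sub>i\<close> for \<open>i < j\<close> thus become those of a bar complex, the outer ones being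
  the 33 relations of \<open>UA\<close>. The face maps exist because the chain modules are
  given by generators and relations, and linear maps out of them are determined on generators.
\<close>

section \<open>Modules given by generators and relations\<close>

text \<open>The obstacle is that the data of a face depend on the shape of the tree, and that
  deleting a leaf may suppress a vertex, so a direct check of \<open>d\<^sub>i d\<^sub>j\<close>
  would run through all local shapes around two leaves. Heights absorb this. They only have to grow
  strictly away from the root and need not be depths: suppressing a vertex forces no relabelling. A
  tree has many labellings; what counts is that each proper tree has one and that a word has at most
  one tree. Two iterated deletions then agree because their results carry the same word, so even the
  simplicial identity for bare trees comes from associativity of \<open>min\<close>. A tree of
  degree \<open>n\<close> has \<open>n\<close> gaps and there are \<open>n\<close> letters, so both
  merge into one word of pairs (height, letter). Each face sends a generator to a generator; hence
  the identities are checked on triples (tree, element of \<open>N\<close>, letters), and the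
  alternating sum cancels in the free module on these triples, away from the quotients that define
  the tensor products.\<close>

lemma ring_type_ring: "ring (type_ring :: 'r::ring_1 ring)"
  by (rule ringI) (auto simp: type_ring_def algebra_simps intro!: abelian_groupI monoidI exI[of _ "- _"])

lemma cring_type_ring: "cring (type_ring :: 'r::comm_ring_1 ring)"
proof -
  interpret ring "type_ring :: 'r ring" by (rule ring_type_ring)
  show ?thesis by unfold_locales (simp add: type_ring_def mult.commute)
qed

lemma type_ring_simps [simp]:
  "carrier type_ring = UNIV" "x \<otimes>\<^bsub>type_ring\<^esub> y = x * y" "\<one>\<^bsub>type_ring\<^esub> = 1"
  "\<zero>\<^bsub>type_ring\<^esub> = 0" "x \<oplus>\<^bsub>type_ring\<^esub> y = x + y"
  by (simp_all add: type_ring_def)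

lemma a_inv_type_ring [simp]: "\<ominus>\<^bsub>type_ring\<^esub> x = - (x::'r::ring_1)"
proof -
  interpret ring "type_ring :: 'r ring" by (rule ring_type_ring)
  show ?thesis by (rule minus_equality) auto
qed

lemma lookup_map_times [simp]: "Poly_Mapping.lookup (Poly_Mapping.map ((*) c) p) k = (c::'k::field) * Poly_Mapping.lookup p k"
  by (simp add: Poly_Mapping.map.rep_eq when_def)

lemma keys_map_times: "Poly_Mapping.keys (Poly_Mapping.map ((*) c) p) \<subseteq> Poly_Mapping.keys (p :: _ \<Rightarrow>\<^sub>0 'k::field)"
  by (auto simp: in_keys_iff)

lemma free_module_simps [simp]:
  "carrier (free_module S) = {f. Poly_Mapping.keys f \<subseteq> S}"
  "\<zero>\<^bsub>free_module S\<^esub> = 0" "x \<oplus>\<^bsub>free_module S\<^esub> y = x + y"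
  "c \<odot>\<^bsub>free_module S\<^esub> x = Poly_Mapping.map ((*) c) x"
  by (simp_all add: free_module_def)

lemma module_free_module: "module type_ring (free_module S :: ('k::field, 'b \<Rightarrow>\<^sub>0 'k) module)"
proof (rule moduleI)
  show "abelian_group (free_module S :: ('k, 'b \<Rightarrow>\<^sub>0 'k) module)"
  proof (rule abelian_groupI)
    fix x :: "'b \<Rightarrow>\<^sub>0 'k" assume "x \<in> carrier (free_module S)"
    then show "\<exists>y\<in>carrier (free_module S). y \<oplus>\<^bsub>free_module S\<^esub> x = \<zero>\<^bsub>free_module S\<^esub>"
      by (intro bexI[of _ "- x"]) auto
  qed (use keys_add in \<open>fastforce simp: algebra_simps\<close>)+
qed (use keys_add keys_map_times in
     \<open>fastforce intro: poly_mapping_eqI cring_type_ring simp: lookup_add algebra_simps\<close>)+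

lemma linear_mapD:
  assumes "linear_map V W f"
  shows "x \<in> carrier V \<Longrightarrow> f x \<in> carrier W"
    and "x \<in> carrier V \<Longrightarrow> y \<in> carrier V \<Longrightarrow> f (x \<oplus>\<^bsub>V\<^esub> y) = f x \<oplus>\<^bsub>W\<^esub> f y"
    and "x \<in> carrier V \<Longrightarrow> f (c \<odot>\<^bsub>V\<^esub> x) = c \<odot>\<^bsub>W\<^esub> f x"
  using assms by (auto simp: linear_map_def)

lemma linear_map_zero:
  assumes "module type_ring V" "module type_ring W" "linear_map V W f"
  shows "f \<zero>\<^bsub>V\<^esub> = \<zero>\<^bsub>W\<^esub>"
proof -
  interpret V: module type_ring V by fact
  interpret W: module type_ring W by fact
  have "f \<zero>\<^bsub>V\<^esub> \<oplus>\<^bsub>W\<^esub> f \<zero>\<^bsub>V\<^esub> = f \<zero>\<^bsub>V\<^esub>"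
    using linear_mapD(2)[OF assms(3), of "\<zero>\<^bsub>V\<^esub>" "\<zero>\<^bsub>V\<^esub>"] by simp
  then show ?thesis using linear_mapD(1)[OF assms(3), of "\<zero>\<^bsub>V\<^esub>"] 
    by (metis V.M.zero_closed W.M.add.r_cancel_one')
qed

lemma linear_map_finsum:
  assumes "module type_ring V" "module type_ring W" "linear_map V W f" "finite I" "g \<in> I \<rightarrow> carrier V"
  shows "f (\<Oplus>\<^bsub>V\<^esub>i\<in>I. g i) = (\<Oplus>\<^bsub>W\<^esub>i\<in>I. f (g i))"
proof -
  interpret V: module type_ring V by fact
  interpret W: module type_ring W by fact
  show ?thesis using assms(4,5)
  proof (induction I)
    case empty
    then show ?case using linear_map_zero[OF assms(1-3)] by simp
  next
    case (insert i I)
    then have "g \<in> I \<rightarrow> carrier V" "g i \<in> carrier V" by auto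
    moreover from this have "(\<lambda>i. f (g i)) \<in> I \<rightarrow> carrier W" "f (g i) \<in> carrier W"
      using linear_mapD(1)[OF assms(3)] by auto
    ultimately show ?case using insert linear_mapD(2)[OF assms(3)] by simp
  qed
qed

lemma linear_map_comp:
  "linear_map U V f \<Longrightarrow> linear_map V W g \<Longrightarrow> linear_map U W (\<lambda>x. g (f x))"
  by (auto simp: linear_map_def Pi_iff)

lemma linear_map_smult:
  assumes "module (type_ring :: 'k::field ring) W" "linear_map V W f"
  shows "linear_map V W (\<lambda>x. c \<odot>\<^bsub>W\<^esub> f x)"
proof -
  interpret W: module type_ring W by fact
  show ?thesis using assms(2)
    by (auto simp: linear_map_def Pi_iff W.smult_r_distr simp flip: W.smult_assoc1[simplified] simp: mult.commute)
qed

lemma linear_map_finsum_fun: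
  assumes "module (type_ring :: 'k::field ring) W" "finite I" "\<And>i. i \<in> I \<Longrightarrow> linear_map V W (f i)"
  shows "linear_map V W (\<lambda>x. \<Oplus>\<^bsub>W\<^esub>i\<in>I. f i x)"
proof -
  interpret W: module type_ring W by fact
  note D = linear_mapD[OF assms(3)]
  have "(\<Oplus>\<^bsub>W\<^esub>i\<in>I. f i (x \<oplus>\<^bsub>V\<^esub> y)) = (\<Oplus>\<^bsub>W\<^esub>i\<in>I. f i x) \<oplus>\<^bsub>W\<^esub> (\<Oplus>\<^bsub>W\<^esub>i\<in>I. f i y)"
    if "x \<in> carrier V" "y \<in> carrier V" for x y
  proof -
    have "(\<Oplus>\<^bsub>W\<^esub>i\<in>I. f i (x \<oplus>\<^bsub>V\<^esub> y)) = (\<Oplus>\<^bsub>W\<^esub>i\<in>I. f i x \<oplus>\<^bsub>W\<^esub> f i y)"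
      using that D by (intro W.M.finsum_cong') auto
    then show ?thesis using that D by (simp add: W.M.finsum_addf Pi_iff)
  qed
  moreover have "(\<Oplus>\<^bsub>W\<^esub>i\<in>I. f i (c \<odot>\<^bsub>V\<^esub> x)) = c \<odot>\<^bsub>W\<^esub> (\<Oplus>\<^bsub>W\<^esub>i\<in>I. f i x)"
    if "x \<in> carrier V" for x c
    using that D assms(2) by (subst W.finsum_smult_ldistr) (auto intro!: W.M.finsum_cong')
  ultimately show ?thesis using D by (auto simp: linear_map_def intro!: W.M.finsum_closed)
qed

definition lin_ext :: "('k::field, 'w) module \<Rightarrow> ('b \<Rightarrow> 'w) \<Rightarrow> ('b \<Rightarrow>\<^sub>0 'k) \<Rightarrow> 'w" where
  "lin_ext W g p = (\<Oplus>\<^bsub>W\<^esub>s\<in>Poly_Mapping.keys p. Poly_Mapping.lookup p s \<odot>\<^bsub>W\<^esub> g s)"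

text \<open>Terms outside the support vanish. A common finite index set is what makes the sums for
  \<open>p\<close>, \<open>q\<close> and \<open>p + q\<close> comparable, their supports being
  different.\<close>

lemma lin_ext_superset:
  assumes "module type_ring W" "g \<in> S \<rightarrow> carrier W" "finite T" "Poly_Mapping.keys p \<subseteq> T" "T \<subseteq> S"
  shows "lin_ext W g p = (\<Oplus>\<^bsub>W\<^esub>s\<in>T. Poly_Mapping.lookup p s \<odot>\<^bsub>W\<^esub> g s)"
proof -
  interpret W: module type_ring W by fact
  show ?thesis unfolding lin_ext_def using assms(2-)
    by (intro W.M.add.finprod_mono_neutral_cong_left) (auto simp: in_keys_iff Pi_iff W.smult_l_null[simplified] subset_iff)
qed

lemma linear_lin_ext:
  fixes W :: "('k::field, 'w) module"
  assumes "module type_ring W" "g \<in> S \<rightarrow> carrier W"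
  shows "linear_map (free_module S) W (lin_ext W g)"
proof -
  interpret W: module type_ring W by fact
  have cl: "c \<odot>\<^bsub>W\<^esub> g s \<in> carrier W" if "s \<in> S" for c s using that assms(2) by auto
  have "lin_ext W g (p + q) = lin_ext W g p \<oplus>\<^bsub>W\<^esub> lin_ext W g q"
    if "Poly_Mapping.keys p \<subseteq> S" "Poly_Mapping.keys q \<subseteq> S" for p q
  proof -
    let ?T = "Poly_Mapping.keys p \<union> Poly_Mapping.keys q"
    have *: "?T \<subseteq> S" "finite ?T" "Poly_Mapping.keys (p + q) \<subseteq> ?T" using that keys_add[of p q] by simp_all
    have [simp]: "g s \<in> carrier W" if "s \<in> ?T" for s using * that assms(2) by auto
    show ?thesis
      using * by (simp add: lin_ext_superset[OF assms *(2) _ *(1)] lookup_add flip: W.M.finsum_addf)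
        (rule W.M.finsum_cong'; auto simp: W.smult_l_distr[simplified])
  qed
  moreover have "lin_ext W g (Poly_Mapping.map ((*) c) p) = c \<odot>\<^bsub>W\<^esub> lin_ext W g p"
    if "Poly_Mapping.keys p \<subseteq> S" for p c
  proof -
    have "lin_ext W g (Poly_Mapping.map ((*) c) p)
        = (\<Oplus>\<^bsub>W\<^esub>s\<in>Poly_Mapping.keys p. c \<odot>\<^bsub>W\<^esub> (Poly_Mapping.lookup p s \<odot>\<^bsub>W\<^esub> g s))"
      using that assms(2) keys_map_times[of c p]
      by (subst lin_ext_superset[OF assms finite_keys _ that])
        (auto intro!: W.M.finsum_cong' simp: W.smult_assoc1[simplified] Pi_iff subset_iff)
    also have "\<dots> = c \<odot>\<^bsub>W\<^esub> lin_ext W g p"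
      unfolding lin_ext_def using cl that by (subst W.finsum_smult_ldistr) auto
    finally show ?thesis .
  qed
  moreover have "lin_ext W g p \<in> carrier W" if "Poly_Mapping.keys p \<subseteq> S" for p
    unfolding lin_ext_def using cl that by (intro W.M.finsum_closed) auto
  ultimately show ?thesis by (auto simp: linear_map_def)
qed

lemma lin_ext_single:
  fixes W :: "('k::field, 'w) module"
  assumes "module type_ring W" "g s \<in> carrier W"
  shows "lin_ext W g (Poly_Mapping.single s c) = c \<odot>\<^bsub>W\<^esub> g s"
proof -
  interpret W: module type_ring W by fact
  show ?thesis using assms(2) by (simp add: lin_ext_def W.smult_l_null[simplified])
qed


section \<open>Generated submodules and quotient modules\<close>

lemma submodule_gen:
  assumes "module (type_ring :: 'k::field ring) M" "S \<subseteq> carrier M"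
  shows "submodule (gen_submodule M S) type_ring M"
    and "S \<subseteq> gen_submodule M S"
proof -
  interpret M: module type_ring M by fact
  let ?F = "{H. submodule H type_ring M \<and> S \<subseteq> H}"
  have F: "carrier M \<in> ?F" using M.carrier_is_submodule assms by simp
  show "submodule (gen_submodule M S) type_ring M"
  proof (rule M.submoduleI)
    show "gen_submodule M S \<subseteq> carrier M" using F by (auto simp: gen_submodule_def)
    fix a b c assume "a \<in> gen_submodule M S"
    then show "\<ominus>\<^bsub>M\<^esub> a \<in> gen_submodule M S" "c \<odot>\<^bsub>M\<^esub> a \<in> gen_submodule M S"
      by (auto simp: gen_submodule_def intro: M.submoduleE)
    assume "b \<in> gen_submodule M S"
    then show "a \<oplus>\<^bsub>M\<^esub> b \<in> gen_submodule M S"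
      using \<open>a \<in> gen_submodule M S\<close> by (auto simp: gen_submodule_def intro: M.submoduleE)
  next
    show "\<zero>\<^bsub>M\<^esub> \<in> gen_submodule M S"
      by (auto simp: gen_submodule_def submodule_def dest: subgroup.one_closed)
  qed
  show "S \<subseteq> gen_submodule M S" by (auto simp: gen_submodule_def)
qed

lemma gen_submodule_least: "submodule H type_ring M \<Longrightarrow> S \<subseteq> H \<Longrightarrow> gen_submodule M S \<subseteq> H"
  by (auto simp: gen_submodule_def)

lemma abelian_subgroup_submodule:
  assumes "module R M" "submodule H R M"
  shows "abelian_subgroup H M"
  using assms by (intro abelian_subgroupI3 additive_subgroup.intro)
    (auto simp: module_def submodule_def)

lemma a_inv_eq_smult:
  assumes "module (type_ring :: 'k::field ring) M" "x \<in> carrier M"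
  shows "\<ominus>\<^bsub>M\<^esub> x = (- 1 :: 'k) \<odot>\<^bsub>M\<^esub> x"
proof -
  interpret M: module "type_ring :: 'k ring" M by fact
  show ?thesis using M.smult_l_minus[of 1 x] M.smult_one[of x] assms(2) by simp
qed

lemma submodule_equalizer:
  assumes "module (type_ring :: 'k::field ring) V" "module (type_ring :: 'k ring) W" "linear_map V W f" "linear_map V W g"
  shows "submodule {x \<in> carrier V. f x = g x} type_ring V"
proof -
  interpret V: module type_ring V by fact
  interpret W: module type_ring W by fact
  show ?thesis
    using linear_mapD[OF assms(3)] linear_mapD[OF assms(4)]
      linear_map_zero[OF assms(1,2,3)] linear_map_zero[OF assms(1,2,4)]
    by (intro V.submoduleI) (auto simp: a_inv_eq_smult[OF assms(1)])
qed

lemma submodule_vimage: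
  assumes "module (type_ring :: 'k::field ring) V" "module (type_ring :: 'k ring) W" "linear_map V W f"
    and K: "submodule K type_ring W"
  shows "submodule {x \<in> carrier V. f x \<in> K} type_ring V"
proof -
  interpret V: module type_ring V by fact
  interpret W: module type_ring W by fact
  have "\<zero>\<^bsub>W\<^esub> \<in> K" using subgroup.one_closed[OF submodule.axioms(1)[OF K]] by simp
  then show ?thesis
    using linear_mapD[OF assms(3)] linear_map_zero[OF assms(1,2,3)] W.submoduleE(4,5)[OF K]
    by (intro V.submoduleI) (auto simp: a_inv_eq_smult[OF assms(1)])
qed

lemma quot_module_simps [simp]:
  "carrier (quot_module M H) = a_rcosets\<^bsub>M\<^esub> H" "\<zero>\<^bsub>quot_module M H\<^esub> = H"
  "x \<oplus>\<^bsub>quot_module M H\<^esub> y = x <+>\<^bsub>M\<^esub> y"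
  by (simp_all add: quot_module_def)

text \<open>The product of \<open>c\<close> with a coset is a union over all representatives. By
  distributivity all of them give the same coset, so the union collapses.\<close>

lemma smult_coset:
  assumes "module (type_ring :: 'k::field ring) M" "submodule H (type_ring :: 'k ring) M" "x \<in> carrier M"
  shows "c \<odot>\<^bsub>quot_module M H\<^esub> (H +>\<^bsub>M\<^esub> x) = H +>\<^bsub>M\<^esub> (c \<odot>\<^bsub>M\<^esub> x)"
proof -
  interpret M: module type_ring M by fact
  interpret abelian_subgroup H M using abelian_subgroup_submodule assms by blast
  have "H +>\<^bsub>M\<^esub> (c \<odot>\<^bsub>M\<^esub> y) = H +>\<^bsub>M\<^esub> (c \<odot>\<^bsub>M\<^esub> x)" if y: "y \<in> H +>\<^bsub>M\<^esub> x" for y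
  proof -
    obtain h where h: "h \<in> H" "y = h \<oplus>\<^bsub>M\<^esub> x" using y by (auto simp: a_r_coset_def')
    have "c \<odot>\<^bsub>M\<^esub> y = (c \<odot>\<^bsub>M\<^esub> h) \<oplus>\<^bsub>M\<^esub> (c \<odot>\<^bsub>M\<^esub> x)" using h assms(3) by (simp add: M.smult_r_distr)
    then have "c \<odot>\<^bsub>M\<^esub> y \<in> H +>\<^bsub>M\<^esub> (c \<odot>\<^bsub>M\<^esub> x)"
      using submodule.smult_closed[OF assms(2), of c h] h by (auto simp: a_r_coset_def')
    then show ?thesis using a_repr_independence' assms(3) by simp
  qed
  then have "(\<Union>y\<in>H +>\<^bsub>M\<^esub> x. H +>\<^bsub>M\<^esub> (c \<odot>\<^bsub>M\<^esub> y)) = H +>\<^bsub>M\<^esub> (c \<odot>\<^bsub>M\<^esub> x)"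
    by (rule UN_constant_eq[OF a_rcos_self[OF assms(3)] ballI])
  then show ?thesis unfolding quot_module_def by (simp only: module.simps)
qed

lemma carrier_quot_module:
  "carrier (quot_module M H) = (\<lambda>x. H +>\<^bsub>M\<^esub> x) ` carrier M"
  by (auto simp: A_RCOSETS_def RCOSETS_def a_r_coset_def)

lemma module_quot_module:
  fixes M :: "('k::field, 'v) module"
  assumes "module type_ring M" "submodule H type_ring M"
  shows "module type_ring (quot_module M H)"
proof -
  interpret M: module type_ring M by fact
  interpret abelian_subgroup H M using abelian_subgroup_submodule assms by blast
  have zero: "H = H +>\<^bsub>M\<^esub> \<zero>\<^bsub>M\<^esub>" using a_rcos_const[of "\<zero>\<^bsub>M\<^esub>"] zero_closed by simp
  have "abelian_group (quot_module M H)"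
  proof (rule abelian_groupI)
    show "\<zero>\<^bsub>quot_module M H\<^esub> \<in> carrier (quot_module M H)"
      using zero M.M.zero_closed unfolding carrier_quot_module by (auto simp del: M.M.zero_closed)
    fix X assume "X \<in> carrier (quot_module M H)"
    then obtain x where x: "x \<in> carrier M" "X = H +>\<^bsub>M\<^esub> x" unfolding carrier_quot_module by blast
    show "\<zero>\<^bsub>quot_module M H\<^esub> \<oplus>\<^bsub>quot_module M H\<^esub> X = X"
      using a_rcos_sum[of "\<zero>\<^bsub>M\<^esub>" x] x zero by simp
    have "(H +>\<^bsub>M\<^esub> (\<ominus>\<^bsub>M\<^esub> x)) <+>\<^bsub>M\<^esub> X = H"
      using a_rcos_sum[of "\<ominus>\<^bsub>M\<^esub> x" x] x zero by (simp add: M.M.l_neg)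
    then show "\<exists>Y\<in>carrier (quot_module M H). Y \<oplus>\<^bsub>quot_module M H\<^esub> X = \<zero>\<^bsub>quot_module M H\<^esub>"
      using x unfolding carrier_quot_module by auto
  next
    fix X Y Z assume "X \<in> carrier (quot_module M H)" "Y \<in> carrier (quot_module M H)"
    then obtain x y where x: "x \<in> carrier M" "X = H +>\<^bsub>M\<^esub> x" "y \<in> carrier M" "Y = H +>\<^bsub>M\<^esub> y"
      unfolding carrier_quot_module by blast
    then show "X \<oplus>\<^bsub>quot_module M H\<^esub> Y \<in> carrier (quot_module M H)"
      unfolding carrier_quot_module by (simp add: a_rcos_sum)
    show "X \<oplus>\<^bsub>quot_module M H\<^esub> Y = Y \<oplus>\<^bsub>quot_module M H\<^esub> X"
      using x by (simp add: a_rcos_sum M.M.a_comm)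
    assume "Z \<in> carrier (quot_module M H)"
    then obtain z where "z \<in> carrier M" "Z = H +>\<^bsub>M\<^esub> z" unfolding carrier_quot_module by blast
    then show "(X \<oplus>\<^bsub>quot_module M H\<^esub> Y) \<oplus>\<^bsub>quot_module M H\<^esub> Z = X \<oplus>\<^bsub>quot_module M H\<^esub> (Y \<oplus>\<^bsub>quot_module M H\<^esub> Z)"
      using x by (simp add: a_rcos_sum M.M.a_assoc)
  qed
  note sm = smult_coset[OF assms]
  show ?thesis
    by (rule moduleI[OF cring_type_ring \<open>abelian_group _\<close>])
      (auto simp: carrier_quot_module sm a_rcos_sum M.smult_l_distr[simplified] M.smult_r_distr[simplified]
        M.smult_assoc1[simplified] M.smult_one[simplified] simp del: quot_module_simps(1))
qed

lemma linear_coset: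
  assumes "module (type_ring :: 'k::field ring) M" "submodule H (type_ring :: 'k ring) M"
  shows "linear_map M (quot_module M H) (\<lambda>x. H +>\<^bsub>M\<^esub> x)"
proof -
  interpret M: module type_ring M by fact
  interpret abelian_subgroup H M using abelian_subgroup_submodule assms by blast
  show ?thesis
    by (auto simp: linear_map_def smult_coset[OF assms] carrier_quot_module a_rcos_sum simp del: quot_module_simps(1))
qed

lemma quot_module_lift:
  fixes M :: "('k::field, 'v) module" and W :: "('k, 'w) module"
  assumes "module type_ring M" "submodule H type_ring M" "module type_ring W" "linear_map M W h"
    "\<And>x. x \<in> H \<Longrightarrow> h x = \<zero>\<^bsub>W\<^esub>"
  shows "\<exists>f. linear_map (quot_module M H) W f \<and> (\<forall>x\<in>carrier M. f (H +>\<^bsub>M\<^esub> x) = h x)"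
proof -
  interpret M: module type_ring M by fact
  interpret W: module type_ring W by fact
  interpret abelian_subgroup H M using abelian_subgroup_submodule assms by blast
  note h = linear_mapD[OF assms(4)]
  \<comment> \<open>The choice is harmless: two representatives differ by an element of
    \<open>H\<close>, which \<open>h\<close> sends to zero.\<close>
  define f where "f X = h (SOME x. x \<in> X)" for X
  have f: "f (H +>\<^bsub>M\<^esub> x) = h x" if x: "x \<in> carrier M" for x
  proof -
    have "(SOME y. y \<in> H +>\<^bsub>M\<^esub> x) \<in> H +>\<^bsub>M\<^esub> x" using a_rcos_self[OF x] by (rule someI)
    then obtain k where "k \<in> H" "(SOME y. y \<in> H +>\<^bsub>M\<^esub> x) = k \<oplus>\<^bsub>M\<^esub> x" by (auto simp: a_r_coset_def')
    then show ?thesis using x h assms(5) by (simp add: f_def)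
  qed
  have "linear_map (quot_module M H) W f"
    unfolding linear_map_def carrier_quot_module
    using h by (auto simp: f smult_coset[OF assms(1,2)] a_rcos_sum)
  then show ?thesis using f by blast
qed

section \<open>Modules presented by generators and relations\<close>

definition presented :: "'b set \<Rightarrow> ('b \<Rightarrow>\<^sub>0 'k) set \<Rightarrow> ('k::field, ('b \<Rightarrow>\<^sub>0 'k) set) module" where
  "presented S R = quot_module (free_module S) (gen_submodule (free_module S) R)"

definition presented_gen :: "'b set \<Rightarrow> ('b \<Rightarrow>\<^sub>0 'k::field) set \<Rightarrow> 'b \<Rightarrow> ('b \<Rightarrow>\<^sub>0 'k) set" where
  "presented_gen S R s =
    gen_submodule (free_module S) R +>\<^bsub>free_module S :: ('k, _) module\<^esub> Poly_Mapping.single s 1"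

text \<open>Phrased with submodules instead of linear combinations: since equalizers and preimages
  are submodules, equality of linear maps and inclusion of images can be tested on generators
  without handling finite sums.\<close>

definition generates :: "('k::field, 'v) module \<Rightarrow> 'v set \<Rightarrow> bool" where
  "generates M G \<longleftrightarrow> G \<subseteq> carrier M \<and> (\<forall>H. submodule H type_ring M \<longrightarrow> G \<subseteq> H \<longrightarrow> carrier M \<subseteq> H)"

lemma generatesD: "generates M G \<Longrightarrow> submodule H type_ring M \<Longrightarrow> G \<subseteq> H \<Longrightarrow> carrier M \<subseteq> H"
  and generates_mem: "generates M G \<Longrightarrow> x \<in> G \<Longrightarrow> x \<in> carrier M"
  by (auto simp: generates_def)

lemma linear_map_eqI:
  assumes "module (type_ring :: 'k::field ring) V" "module (type_ring :: 'k ring) W"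
    "linear_map V W f" "linear_map V W g" "generates V G" "\<And>x. x \<in> G \<Longrightarrow> f x = g x" "x \<in> carrier V"
  shows "f x = g x"
proof -
  have "carrier V \<subseteq> {x \<in> carrier V. f x = g x}"
    using assms(5,6) submodule_equalizer[OF assms(1-4)] by (force simp: generates_def)
  then show ?thesis using assms(7) by blast
qed

lemma generates_free_module: 
  "generates (free_module S :: ('k::field, 'b \<Rightarrow>\<^sub>0 'k) module) ((\<lambda>s. Poly_Mapping.single s 1) ` S)"
  unfolding generates_def
proof (intro conjI allI impI subsetI)
  fix H and p :: "'b \<Rightarrow>\<^sub>0 'k"
  let ?F = "free_module S :: ('k::field, 'b \<Rightarrow>\<^sub>0 'k) module"
  interpret F: module type_ring ?F by (rule module_free_module)
  assume H: "submodule H type_ring ?F" and S: "(\<lambda>s. Poly_Mapping.single s 1) ` S \<subseteq> H"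
    and p: "p \<in> carrier ?F"
  have cl: "Poly_Mapping.single s c \<in> H" if "s \<in> S" for s c
    using F.submoduleE(4)[OF H, of c "Poly_Mapping.single s 1"] S that by auto
  have "p \<in> H" if "Poly_Mapping.keys p \<subseteq> S" for p
    using that
  proof (induction p rule: update_induct)
    case const
    show ?case using subgroup.one_closed[OF submodule.axioms(1)[OF H]] by simp
  next
    case (update q s c)
    have "Poly_Mapping.update s c q = q + Poly_Mapping.single s c"
      using update(1) by (intro poly_mapping_eqI) (auto simp: lookup_update lookup_add lookup_single in_keys_iff)
    moreover have "s \<in> S" "Poly_Mapping.keys q \<subseteq> S" using update by (auto simp: keys_update)
    ultimately show ?case using F.submoduleE(5)[OF H, of q "Poly_Mapping.single s c"] update(3) cl by simp
  qed
  then show "p \<in> H" using p by simp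
qed auto

lemma presented_simps:
  fixes R :: "('b \<Rightarrow>\<^sub>0 'k::field) set"
  assumes "R \<subseteq> carrier (free_module S :: ('k, 'b \<Rightarrow>\<^sub>0 'k) module)"
  shows module_presented: "module type_ring (presented S R)"
    and generates_presented: "generates (presented S R) (presented_gen S R ` S)"
proof -
  let ?F = "free_module S :: ('k::field, 'b \<Rightarrow>\<^sub>0 'k) module"
  let ?H = "gen_submodule ?F R"
  interpret F: module type_ring ?F by (rule module_free_module)
  have H: "submodule ?H type_ring ?F" using submodule_gen(1) F.module_axioms assms by blast
  show Q: "module type_ring (presented S R)"
    unfolding presented_def by (rule module_quot_module[OF F.module_axioms H])
  interpret Q: module type_ring "presented S R" by fact
  have lin: "linear_map ?F (presented S R) (\<lambda>x. ?H +>\<^bsub>?F\<^esub> x)"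
    unfolding presented_def by (rule linear_coset[OF F.module_axioms H])
  show "generates (presented S R) (presented_gen S R ` S)"
    unfolding generates_def
  proof (intro conjI allI impI)
    show "presented_gen S R ` S \<subseteq> carrier (presented S R)"
      using linear_mapD(1)[OF lin] by (auto simp: presented_gen_def)
    fix K assume K: "submodule K type_ring (presented S R)" "presented_gen S R ` S \<subseteq> K"
    have "submodule {x \<in> carrier ?F. ?H +>\<^bsub>?F\<^esub> x \<in> K} type_ring ?F"
      by (rule submodule_vimage[OF F.module_axioms Q lin K(1)])
    moreover have "(\<lambda>s. Poly_Mapping.single s 1) ` S \<subseteq> {x \<in> carrier ?F. ?H +>\<^bsub>?F\<^esub> x \<in> K}"
      using K(2) by (auto simp: presented_gen_def)
    ultimately have "carrier ?F \<subseteq> {x \<in> carrier ?F. ?H +>\<^bsub>?F\<^esub> x \<in> K}"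
      by (rule generatesD[OF generates_free_module])
    then show "carrier (presented S R) \<subseteq> K"
      unfolding presented_def carrier_quot_module by blast
  qed
qed

text \<open>The zero set of the linear extension is a submodule containing the relations, hence it
  contains everything they generate.\<close>

lemma presented_lift:
  fixes R :: "('b \<Rightarrow>\<^sub>0 'k::field) set" and W :: "('k, 'w) module"
  assumes R: "R \<subseteq> carrier (free_module S :: ('k, 'b \<Rightarrow>\<^sub>0 'k) module)"
    and W: "module type_ring W" and g: "g \<in> S \<rightarrow> carrier W" "\<And>r. r \<in> R \<Longrightarrow> lin_ext W g r = \<zero>\<^bsub>W\<^esub>"
  shows "\<exists>f. linear_map (presented S R) W f \<and> (\<forall>s\<in>S. f (presented_gen S R s) = g s)"
proof -
  let ?F = "free_module S :: ('k::field, 'b \<Rightarrow>\<^sub>0 'k) module"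
  let ?H = "gen_submodule ?F R"
  interpret F: module type_ring ?F by (rule module_free_module)
  interpret W: module type_ring W by fact
  have H: "submodule ?H type_ring ?F" using submodule_gen(1) F.module_axioms assms by blast
  have lin: "linear_map ?F W (lin_ext W g)" by (rule linear_lin_ext[OF W g(1)])
  have "linear_map ?F W (\<lambda>x. \<zero>\<^bsub>W\<^esub>)" by (auto simp: linear_map_def W.smult_r_null[simplified])
  then have "submodule {x \<in> carrier ?F. lin_ext W g x = \<zero>\<^bsub>W\<^esub>} type_ring ?F"
    by (rule submodule_equalizer[OF F.module_axioms W lin])
  then have "?H \<subseteq> {x \<in> carrier ?F. lin_ext W g x = \<zero>\<^bsub>W\<^esub>}"
    by (rule gen_submodule_least) (use g(2) R in blast)
  then have "\<exists>f. linear_map (quot_module ?F ?H) W f \<and> (\<forall>x\<in>carrier ?F. f (?H +>\<^bsub>?F\<^esub> x) = lin_ext W g x)"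
    by (intro quot_module_lift F.module_axioms H W lin) auto
  then obtain f where f: "linear_map (presented S R) W f" "\<And>x. x \<in> carrier ?F \<Longrightarrow> f (?H +>\<^bsub>?F\<^esub> x) = lin_ext W g x"
    unfolding presented_def by blast
  have "f (presented_gen S R s) = g s" if "s \<in> S" for s
    using f(2)[of "Poly_Mapping.single s 1"] g(1) that
    by (auto simp: presented_gen_def lin_ext_single[OF W] W.smult_one[simplified] Pi_iff)
  then show ?thesis using f(1) by blast
qed

text \<open>The coset projection agrees on basis elements with the linear extension of
  \<open>presented_gen\<close>, hence everywhere, and it kills the relations.\<close>

lemma presented_relation:
  fixes R :: "('b \<Rightarrow>\<^sub>0 'k::field) set"
  assumes R: "R \<subseteq> carrier (free_module S :: ('k, 'b \<Rightarrow>\<^sub>0 'k) module)" and "r \<in> R"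
  shows "lin_ext (presented S R) (presented_gen S R) r = \<zero>\<^bsub>presented S R\<^esub>"
proof -
  let ?F = "free_module S :: ('k::field, 'b \<Rightarrow>\<^sub>0 'k) module"
  let ?H = "gen_submodule ?F R"
  interpret F: module type_ring ?F by (rule module_free_module)
  have H: "submodule ?H type_ring ?F" "R \<subseteq> ?H" using submodule_gen F.module_axioms assms by blast+
  interpret abelian_subgroup ?H ?F using abelian_subgroup_submodule H F.module_axioms by blast
  note Q = module_presented[OF R]
  interpret Q: module type_ring "presented S R" by fact
  have c: "linear_map ?F (presented S R) (\<lambda>x. ?H +>\<^bsub>?F\<^esub> x)"
    unfolding presented_def by (rule linear_coset[OF F.module_axioms H(1)])
  have g: "presented_gen S R \<in> S \<rightarrow> carrier (presented S R)"
    using generates_presented[OF R] unfolding generates_def by blast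
  have "lin_ext (presented S R) (presented_gen S R) r = ?H +>\<^bsub>?F\<^esub> r"
  proof (rule linear_map_eqI[OF F.module_axioms Q linear_lin_ext[OF Q g] c generates_free_module])
    show "r \<in> carrier ?F" using assms by blast
    fix x assume "x \<in> (\<lambda>s. Poly_Mapping.single s (1::'k)) ` S"
    then obtain s where s: "s \<in> S" "x = Poly_Mapping.single s 1" by blast
    then have "presented_gen S R s \<in> carrier (presented S R)" using g by blast
    then show "lin_ext (presented S R) (presented_gen S R) x = ?H +>\<^bsub>?F\<^esub> x"
      by (simp add: s lin_ext_single[OF Q] Q.smult_one[simplified]) (simp add: presented_gen_def)
  qed
  also have "\<dots> = \<zero>\<^bsub>presented S R\<^esub>" using a_rcos_const H(2) assms(2) by (auto simp: presented_def)
  finally show ?thesis .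
qed

section \<open>Multilinear maps and tensor products\<close>

lemma linear_map_add_fun:
  assumes "module (type_ring :: 'k::field ring) W" "linear_map V W f" "linear_map V W g"
  shows "linear_map V W (\<lambda>x. f x \<oplus>\<^bsub>W\<^esub> g x)"
proof -
  interpret W: module type_ring W by fact
  note f = linear_mapD[OF assms(2)] and g = linear_mapD[OF assms(3)]
  show ?thesis unfolding linear_map_def using f g
    by (auto simp: W.M.a_ac W.smult_r_distr[simplified])
qed

lemma lin_ext_diff:
  fixes W :: "('k::field, 'w) module"
  assumes "module type_ring W" "g \<in> S \<rightarrow> carrier W" "Poly_Mapping.keys p \<subseteq> S" "Poly_Mapping.keys q \<subseteq> S"
  shows "lin_ext W g (p - q) = lin_ext W g p \<ominus>\<^bsub>W\<^esub> lin_ext W g q"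
proof -
  interpret W: module type_ring W by fact
  note L = linear_mapD[OF linear_lin_ext[OF assms(1,2)]]
  have "p - q = p \<oplus>\<^bsub>free_module S\<^esub> ((- 1) \<odot>\<^bsub>free_module S\<^esub> q)"
    by (auto intro!: poly_mapping_eqI simp: lookup_add lookup_minus)
  also have "lin_ext W g \<dots> = lin_ext W g p \<oplus>\<^bsub>W\<^esub> ((- 1) \<odot>\<^bsub>W\<^esub> lin_ext W g q)"
    using assms(3,4) L keys_map_times[of "-1" q] by (subst L(2)) auto
  also have "\<dots> = lin_ext W g p \<ominus>\<^bsub>W\<^esub> lin_ext W g q"
    using L(1)[of q] assms(4) by (simp add: a_minus_def a_inv_eq_smult[OF assms(1)])
  finally show ?thesis .
qed

lemma minus_eq_zero_iff:
  assumes "abelian_group G" "x \<in> carrier G" "y \<in> carrier G"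
  shows "x \<ominus>\<^bsub>G\<^esub> y = \<zero>\<^bsub>G\<^esub> \<longleftrightarrow> x = y"
proof -
  interpret abelian_group G by fact
  show ?thesis using assms(2,3) unfolding a_minus_def
    by (metis a_inv_closed minus_equality minus_minus r_neg)
qed

text \<open>Used in both directions: from left to right it turns the relations of a tensor product
  into additivity of pure tensors, from right to left it turns additivity of a given map into
  vanishing on the relations.\<close>

lemma lin_ext_add_relation:
  fixes W :: "('k::field, 'w) module"
  assumes "module type_ring W" "g \<in> S \<rightarrow> carrier W" "s \<in> S" "t \<in> S" "u \<in> S"
  shows "lin_ext W g (Poly_Mapping.single s 1 - Poly_Mapping.single t 1 - Poly_Mapping.single u 1) = \<zero>\<^bsub>W\<^esub>
      \<longleftrightarrow> g s = g t \<oplus>\<^bsub>W\<^esub> g u"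
proof -
  interpret W: module type_ring W by fact
  have g: "g s \<in> carrier W" "g t \<in> carrier W" "g u \<in> carrier W" using assms by auto
  have "Poly_Mapping.keys (Poly_Mapping.single s 1 - Poly_Mapping.single t 1 :: _ \<Rightarrow>\<^sub>0 'k) \<subseteq> S"
    using assms keys_diff[of "Poly_Mapping.single s (1::'k)" "Poly_Mapping.single t 1"] by auto
  then have "lin_ext W g (Poly_Mapping.single s 1 - Poly_Mapping.single t 1 - Poly_Mapping.single u 1)
      = g s \<ominus>\<^bsub>W\<^esub> g t \<ominus>\<^bsub>W\<^esub> g u"
    using assms by (simp add: lin_ext_diff[OF assms(1,2)] lin_ext_single[OF assms(1)] g W.smult_one[simplified])
  also have "\<dots> = g s \<ominus>\<^bsub>W\<^esub> (g t \<oplus>\<^bsub>W\<^esub> g u)"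
    using g by (simp add: a_minus_def W.M.a_ac W.M.minus_add)
  finally show ?thesis
    using g minus_eq_zero_iff[OF W.M.abelian_group_axioms] W.M.a_closed by metis
qed

lemma lin_ext_smult_relation:
  fixes W :: "('k::field, 'w) module"
  assumes "module type_ring W" "g \<in> S \<rightarrow> carrier W" "s \<in> S" "t \<in> S"
  shows "lin_ext W g (Poly_Mapping.single s 1 - Poly_Mapping.single t c) = \<zero>\<^bsub>W\<^esub> \<longleftrightarrow> g s = c \<odot>\<^bsub>W\<^esub> g t"
proof -
  interpret W: module type_ring W by fact
  have g: "g s \<in> carrier W" "g t \<in> carrier W" using assms by auto
  have "lin_ext W g (Poly_Mapping.single s 1 - Poly_Mapping.single t c) = g s \<ominus>\<^bsub>W\<^esub> c \<odot>\<^bsub>W\<^esub> g t"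
    using assms by (simp add: lin_ext_diff[OF assms(1,2)] lin_ext_single[OF assms(1)] g W.smult_one[simplified])
  then show ?thesis
    using g minus_eq_zero_iff[OF W.M.abelian_group_axioms] W.smult_closed[of c] by simp
qed

definition bilinear_map :: "('k::field, 'u) module \<Rightarrow> ('k, 'v) module \<Rightarrow> ('k, 'w) module \<Rightarrow> ('u \<Rightarrow> 'v \<Rightarrow> 'w) \<Rightarrow> bool" where
  "bilinear_map U V W b \<longleftrightarrow>
     (\<forall>v\<in>carrier V. linear_map U W (\<lambda>u. b u v)) \<and> (\<forall>u\<in>carrier U. linear_map V W (b u))"

text \<open>Varying one slot of a full tuple by \<open>a[i := v]\<close> is the form of the
  relations in \<open>tensor_power_rels\<close>; for \<open>n = 0\<close> only the value on the
  empty list is constrained.\<close>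

definition multilinear_map :: "('k::field, 'v) module \<Rightarrow> nat \<Rightarrow> ('k, 'w) module \<Rightarrow> ('v list \<Rightarrow> 'w) \<Rightarrow> bool" where
  "multilinear_map V n W g \<longleftrightarrow> g \<in> tuples V n \<rightarrow> carrier W \<and>
     (\<forall>a\<in>tuples V n. \<forall>i<n. linear_map V W (\<lambda>v. g (a[i := v])))"

lemma tensor_presented:
  "tensor V W = presented (carrier V \<times> carrier W) (tensor_rels V W)"
  "pure_tensor V W v w = presented_gen (carrier V \<times> carrier W) (tensor_rels V W) (v, w)"
  by (simp_all add: tensor_def presented_def tensor_null_def pure_tensor_def presented_gen_def)

lemma tensor_power_presented:
  "tensor_power V n = presented (tuples V n) (tensor_power_rels V n)"
  "pure_power V n a = presented_gen (tuples V n) (tensor_power_rels V n) a"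
  by (simp_all add: tensor_power_def presented_def tensor_power_null_def pure_power_def presented_gen_def)

lemma keys_relations:
  "s \<in> S \<Longrightarrow> t \<in> S \<Longrightarrow> u \<in> S \<Longrightarrow>
    Poly_Mapping.keys (Poly_Mapping.single s 1 - Poly_Mapping.single t 1 - Poly_Mapping.single u 1 :: _ \<Rightarrow>\<^sub>0 'k::field) \<subseteq> S"
  "s \<in> S \<Longrightarrow> t \<in> S \<Longrightarrow> Poly_Mapping.keys (Poly_Mapping.single s 1 - Poly_Mapping.single t (c :: 'k)) \<subseteq> S"
  by (auto simp: in_keys_iff lookup_minus lookup_single when_def split: if_splits)

lemma tensor_rels_subset:
  fixes V :: "('k::field, 'v) module" and W :: "('k, 'w) module"
  assumes "module type_ring V" "module type_ring W"
  shows "tensor_rels V W \<subseteq> carrier (free_module (carrier V \<times> carrier W) :: ('k, _) module)"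
proof -
  interpret V: module type_ring V by fact
  interpret W: module type_ring W by fact
  have [simp]: "v \<in> carrier V \<Longrightarrow> c \<odot>\<^bsub>V\<^esub> v \<in> carrier V" "w \<in> carrier W \<Longrightarrow> c \<odot>\<^bsub>W\<^esub> w \<in> carrier W" for c v w
    by auto
  show ?thesis unfolding tensor_rels_def free_module_simps
    by (rule subsetI) (elim UnE CollectE exE conjE; hypsubst; intro CollectI keys_relations; simp)
qed

lemma tuples_update: "a \<in> tuples V n \<Longrightarrow> v \<in> carrier V \<Longrightarrow> a[i := v] \<in> tuples V n"
  using set_update_subset_insert by (fastforce simp: tuples_def)

lemma tensor_power_rels_subset:
  fixes V :: "('k::field, 'v) module"
  assumes "module type_ring V"
  shows "tensor_power_rels V n \<subseteq> carrier (free_module (tuples V n) :: ('k, _) module)"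
proof -
  interpret V: module type_ring V by fact
  have [simp]: "v \<in> carrier V \<Longrightarrow> c \<odot>\<^bsub>V\<^esub> v \<in> carrier V" for c v
    by auto
  show ?thesis unfolding tensor_power_rels_def free_module_simps
    by (rule subsetI) (elim UnE CollectE exE conjE; hypsubst; intro CollectI keys_relations; simp add: tuples_update)
qed

lemma module_tensor:
  assumes "module (type_ring :: 'k::field ring) V" "module (type_ring :: 'k ring) W"
  shows "module type_ring (tensor V W)"
  unfolding tensor_presented by (rule module_presented[OF tensor_rels_subset[OF assms]])

lemma module_tensor_power:
  assumes "module (type_ring :: 'k::field ring) V"
  shows "module type_ring (tensor_power V n)"
  unfolding tensor_power_presented by (rule module_presented[OF tensor_power_rels_subset[OF assms]])

lemma bilinear_pure_tensor:
  fixes V :: "('k::field, 'v) module" and W :: "('k, 'w) module"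
  assumes "module type_ring V" "module type_ring W"
  shows "bilinear_map V W (tensor V W) (pure_tensor V W)"
proof -
  interpret V: module type_ring V by fact
  interpret W: module type_ring W by fact
  let ?S = "carrier V \<times> carrier W" and ?R = "tensor_rels V W"
  note R = tensor_rels_subset[OF assms]
  have g: "presented_gen ?S ?R \<in> ?S \<rightarrow> carrier (presented ?S ?R)"
    using generates_presented[OF R] by (auto simp: generates_def)
  note rel = presented_relation[OF R] lin_ext_add_relation[OF module_presented[OF R] g]
    lin_ext_smult_relation[OF module_presented[OF R] g]
  have cl [simp]: "v \<in> carrier V \<Longrightarrow> c \<odot>\<^bsub>V\<^esub> v \<in> carrier V" "w \<in> carrier W \<Longrightarrow> c \<odot>\<^bsub>W\<^esub> w \<in> carrier W" for c v w
    by auto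
  show ?thesis
    unfolding bilinear_map_def linear_map_def tensor_presented
  proof (intro conjI ballI allI)
    fix v v' w w' c assume v: "v \<in> carrier V" "v' \<in> carrier V" "w \<in> carrier W" "w' \<in> carrier W"
    show "presented_gen ?S ?R (v \<oplus>\<^bsub>V\<^esub> v', w) = presented_gen ?S ?R (v, w) \<oplus>\<^bsub>presented ?S ?R\<^esub> presented_gen ?S ?R (v', w)"
      by (rule rel(2)[THEN iffD1, OF _ _ _ rel(1)]) (use v in \<open>auto simp: tensor_rels_def\<close>)
    show "presented_gen ?S ?R (v, w \<oplus>\<^bsub>W\<^esub> w') = presented_gen ?S ?R (v, w) \<oplus>\<^bsub>presented ?S ?R\<^esub> presented_gen ?S ?R (v, w')"
      by (rule rel(2)[THEN iffD1, OF _ _ _ rel(1)]) (use v in \<open>auto simp: tensor_rels_def\<close>)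
    show "presented_gen ?S ?R (c \<odot>\<^bsub>V\<^esub> v, w) = c \<odot>\<^bsub>presented ?S ?R\<^esub> presented_gen ?S ?R (v, w)"
      by (rule rel(3)[THEN iffD1, OF _ _ rel(1)]) (use v in \<open>auto simp: tensor_rels_def\<close>)
    show "presented_gen ?S ?R (v, c \<odot>\<^bsub>W\<^esub> w) = c \<odot>\<^bsub>presented ?S ?R\<^esub> presented_gen ?S ?R (v, w)"
      by (rule rel(3)[THEN iffD1, OF _ _ rel(1)]) (use v in \<open>auto simp: tensor_rels_def\<close>)
  qed (use g in auto)
qed

lemma multilinear_pure_power:
  fixes V :: "('k::field, 'v) module"
  assumes "module type_ring V"
  shows "multilinear_map V n (tensor_power V n) (pure_power V n)"
proof -
  interpret V: module type_ring V by fact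
  let ?S = "tuples V n" and ?R = "tensor_power_rels V n"
  note R = tensor_power_rels_subset[OF assms]
  have g: "presented_gen ?S ?R \<in> ?S \<rightarrow> carrier (presented ?S ?R)"
    using generates_presented[OF R] by (auto simp: generates_def)
  note rel = presented_relation[OF R] lin_ext_add_relation[OF module_presented[OF R] g]
    lin_ext_smult_relation[OF module_presented[OF R] g]
  have cl [simp]: "v \<in> carrier V \<Longrightarrow> c \<odot>\<^bsub>V\<^esub> v \<in> carrier V" for c v
    by auto
  show ?thesis
    unfolding multilinear_map_def linear_map_def tensor_power_presented
  proof (intro conjI ballI allI impI)
    fix a i v v' c assume a: "a \<in> tuples V n" "i < n" "v \<in> carrier V" "v' \<in> carrier V"
    note t = tuples_update[OF a(1)]
    show "presented_gen ?S ?R (a[i := v \<oplus>\<^bsub>V\<^esub> v']) = presented_gen ?S ?R (a[i := v]) \<oplus>\<^bsub>presented ?S ?R\<^esub> presented_gen ?S ?R (a[i := v'])"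
      by (rule rel(2)[THEN iffD1, OF _ _ _ rel(1)]) (use a t in \<open>auto simp: tensor_power_rels_def\<close>)
    show "presented_gen ?S ?R (a[i := c \<odot>\<^bsub>V\<^esub> v]) = c \<odot>\<^bsub>presented ?S ?R\<^esub> presented_gen ?S ?R (a[i := v])"
      by (rule rel(3)[THEN iffD1, OF _ _ rel(1)]) (use a t in \<open>auto simp: tensor_power_rels_def\<close>)
  qed (auto intro: funcset_mem[OF g] tuples_update)
qed

lemma tensor_lift:
  fixes V :: "('k::field, 'v) module" and W :: "('k, 'w) module" and U :: "('k, 'u) module"
  assumes "module type_ring V" "module type_ring W" "module type_ring U" and b: "bilinear_map V W U b"
  shows "\<exists>f. linear_map (tensor V W) U f \<and> (\<forall>v\<in>carrier V. \<forall>w\<in>carrier W. f (pure_tensor V W v w) = b v w)"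
proof -
  interpret V: module type_ring V by fact
  interpret W: module type_ring W by fact
  let ?S = "carrier V \<times> carrier W" and ?R = "tensor_rels V W"
  have bl: "linear_map V U (\<lambda>v. b v w)" if "w \<in> carrier W" for w
    using b that by (simp add: bilinear_map_def)
  have br: "linear_map W U (\<lambda>w. b v w)" if "v \<in> carrier V" for v
    using b that by (simp add: bilinear_map_def)
  have g: "case_prod b \<in> ?S \<rightarrow> carrier U"
    using linear_mapD(1)[OF bl] by auto
  note rel = lin_ext_add_relation[OF assms(3) g, THEN iffD2]
    lin_ext_smult_relation[OF assms(3) g, THEN iffD2]
  have cl [simp]: "v \<in> carrier V \<Longrightarrow> c \<odot>\<^bsub>V\<^esub> v \<in> carrier V" "w \<in> carrier W \<Longrightarrow> c \<odot>\<^bsub>W\<^esub> w \<in> carrier W" for c v w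
    by auto
  have "lin_ext U (case_prod b) r = \<zero>\<^bsub>U\<^esub>" if "r \<in> ?R" for r
    using that unfolding tensor_rels_def
    by (elim UnE; clarify; intro rel)
      (simp_all add: linear_mapD(2,3)[OF bl] linear_mapD(2,3)[OF br])
  from presented_lift[OF tensor_rels_subset[OF assms(1,2)] assms(3) g this]
  show ?thesis unfolding tensor_presented by auto
qed

lemma tensor_power_lift:
  fixes V :: "('k::field, 'v) module" and U :: "('k, 'u) module"
  assumes "module type_ring V" "module type_ring U" and g: "multilinear_map V n U g"
  shows "\<exists>f. linear_map (tensor_power V n) U f \<and> (\<forall>a\<in>tuples V n. f (pure_power V n a) = g a)"
proof -
  interpret V: module type_ring V by fact
  let ?S = "tuples V n" and ?R = "tensor_power_rels V n"
  have gl: "linear_map V U (\<lambda>v. g (a[i := v]))" if "a \<in> ?S" "i < n" for a i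
    using g that by (simp add: multilinear_map_def)
  have g: "g \<in> ?S \<rightarrow> carrier U"
    using g by (simp add: multilinear_map_def)
  note rel = lin_ext_add_relation[OF assms(2) g, THEN iffD2]
    lin_ext_smult_relation[OF assms(2) g, THEN iffD2]
  have cl [simp]: "v \<in> carrier V \<Longrightarrow> c \<odot>\<^bsub>V\<^esub> v \<in> carrier V" for c v
    by auto
  have "lin_ext U g r = \<zero>\<^bsub>U\<^esub>" if "r \<in> ?R" for r
    using that unfolding tensor_power_rels_def
    by (elim UnE; clarify; intro rel)
      (simp_all add: linear_mapD(2,3)[OF gl] tuples_update)
  from presented_lift[OF tensor_power_rels_subset[OF assms(1)] assms(2) g this]
  show ?thesis unfolding tensor_power_presented .
qed

lemma generates_tensor_power:
  fixes V :: "('k::field, 'v) module"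
  assumes "module type_ring V"
  shows "generates (tensor_power V n) (pure_power V n ` tuples V n)"
  unfolding tensor_power_presented
  by (rule generates_presented[OF tensor_power_rels_subset[OF assms]])

text \<open>With one factor fixed a pure tensor is linear in the other, so preimages of a submodule
  are submodules. Doing this on the left and then on the right spreads membership from
  \<open>G \<times> H\<close> to all pure tensors.\<close>

lemma generates_tensor:
  fixes V :: "('k::field, 'v) module" and W :: "('k, 'w) module"
  assumes "module type_ring V" "module type_ring W" "generates V G" "generates W H"
  shows "generates (tensor V W) ((\<lambda>(g, h). pure_tensor V W g h) ` (G \<times> H))"
proof -
  note b = bilinear_pure_tensor[OF assms(1,2)]
  note T = module_tensor[OF assms(1,2)]
  have lv: "linear_map V (tensor V W) (\<lambda>v. pure_tensor V W v w)" if "w \<in> carrier W" for w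
    using b that by (simp add: bilinear_map_def)
  have lw: "linear_map W (tensor V W) (\<lambda>w. pure_tensor V W v w)" if "v \<in> carrier V" for v
    using b that by (simp add: bilinear_map_def)
  show ?thesis
    unfolding generates_def
  proof (intro conjI allI impI)
    show "(\<lambda>(g, h). pure_tensor V W g h) ` (G \<times> H) \<subseteq> carrier (tensor V W)"
      using linear_mapD(1)[OF lv] generates_mem[OF assms(3)] generates_mem[OF assms(4)] by auto
    fix K assume K: "submodule K type_ring (tensor V W)" "(\<lambda>(g, h). pure_tensor V W g h) ` (G \<times> H) \<subseteq> K"
    have 1: "pure_tensor V W v h \<in> K" if "v \<in> carrier V" "h \<in> H" for v h
    proof -
      have "carrier V \<subseteq> {v \<in> carrier V. pure_tensor V W v h \<in> K}"
        by (rule generatesD[OF assms(3) submodule_vimage[OF assms(1) T lv K(1)]])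
          (use that K(2) generates_mem[OF assms(3)] generates_mem[OF assms(4)] in auto)
      then show ?thesis using that by blast
    qed
    have 2: "pure_tensor V W v w \<in> K" if "v \<in> carrier V" "w \<in> carrier W" for v w
    proof -
      have "carrier W \<subseteq> {w \<in> carrier W. pure_tensor V W v w \<in> K}"
        by (rule generatesD[OF assms(4) submodule_vimage[OF assms(2) T lw K(1)]])
          (use that 1 generates_mem[OF assms(4)] in auto)
      then show ?thesis using that by blast
    qed
    show "carrier (tensor V W) \<subseteq> K"
      unfolding tensor_presented(1)
      by (rule generatesD[OF generates_presented[OF tensor_rels_subset[OF assms(1,2)]]])
        (use 2 K(1) in \<open>auto simp: tensor_presented\<close>)
  qed
qed

section \<open>The universal property of the threefold tensor product of trees, coefficients and
  letters\<close>

definition tree_tensor where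
  "tree_tensor T N V n = tensor (free_module T) (tensor N (tensor_power V n))"

definition tree_gen where
  "tree_gen T N V n \<psi> x a = pure_tensor (free_module T) (tensor N (tensor_power V n))
     (Poly_Mapping.single \<psi> 1) (pure_tensor N (tensor_power V n) x (pure_power V n a))"

text \<open>Trees are basis indices, so a map out of this module may depend on the tree arbitrarily;
  it only has to be linear in \<open>x\<close> and multilinear in \<open>a\<close>. This freedom is
  essential, as the formula of a face changes with the tree. The lift is built from the innermost
  factor outwards.\<close>

lemma tree_tensor:
  fixes N :: "('k::field, 'n) module" and V :: "('k, 'v) module"
  assumes N: "module type_ring N" and V: "module type_ring V"
  shows module_tree_tensor: "module type_ring (tree_tensor T N V n)"
    and generates_tree_tensor:
      "generates (tree_tensor T N V n) ((\<lambda>(\<psi>, x, a). tree_gen T N V n \<psi> x a) ` (T \<times> carrier N \<times> tuples V n))"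
    and tree_tensor_lift: "\<lbrakk>module type_ring (U :: ('k, 'u) module);
      \<And>\<psi> x. \<psi> \<in> T \<Longrightarrow> x \<in> carrier N \<Longrightarrow> multilinear_map V n U (F \<psi> x);
      \<And>\<psi> a. \<psi> \<in> T \<Longrightarrow> a \<in> tuples V n \<Longrightarrow> linear_map N U (\<lambda>x. F \<psi> x a)\<rbrakk> \<Longrightarrow>
      \<exists>f. linear_map (tree_tensor T N V n) U f \<and>
        (\<forall>\<psi>\<in>T. \<forall>x\<in>carrier N. \<forall>a\<in>tuples V n. f (tree_gen T N V n \<psi> x a) = F \<psi> x a)"
    and multilinear_tree_gen: "\<psi> \<in> T \<Longrightarrow> x \<in> carrier N \<Longrightarrow> multilinear_map V n (tree_tensor T N V n) (tree_gen T N V n \<psi> x)"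
    and linear_tree_gen: "\<psi> \<in> T \<Longrightarrow> a \<in> tuples V n \<Longrightarrow> linear_map N (tree_tensor T N V n) (\<lambda>x. tree_gen T N V n \<psi> x a)"
proof -
  let ?P = "tensor_power V n" and ?F = "free_module T :: ('k, _) module"
  let ?T = "tensor N ?P"
  note P = module_tensor_power[OF V, of n]
  note T = module_tensor[OF N P]
  note F = module_free_module[where ?'k = 'k, of T]
  interpret N: module type_ring N by fact
  show "module type_ring (tree_tensor T N V n)"
    unfolding tree_tensor_def by (rule module_tensor[OF F T])
  have "generates (tree_tensor T N V n) ((\<lambda>(p, t). pure_tensor ?F ?T p t) `
    ((\<lambda>s. Poly_Mapping.single s 1) ` T \<times> (\<lambda>(x, t). pure_tensor N ?P x t) ` (carrier N \<times> pure_power V n ` tuples V n)))"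
    unfolding tree_tensor_def
    by (rule generates_tensor[OF F T generates_free_module generates_tensor[OF N P _ generates_tensor_power[OF V]]])
      (simp add: generates_def)
  also have "(\<lambda>(p, t). pure_tensor ?F ?T p t) `
    ((\<lambda>s. Poly_Mapping.single s 1) ` T \<times> (\<lambda>(x, t). pure_tensor N ?P x t) ` (carrier N \<times> pure_power V n ` tuples V n))
    = (\<lambda>(\<psi>, x, a). tree_gen T N V n \<psi> x a) ` (T \<times> carrier N \<times> tuples V n)"
    unfolding tree_gen_def by force
  finally show "generates (tree_tensor T N V n) ((\<lambda>(\<psi>, x, a). tree_gen T N V n \<psi> x a) ` (T \<times> carrier N \<times> tuples V n))" .
  have pw: "pure_power V n a \<in> carrier ?P" if "a \<in> tuples V n" for a
    using generates_mem[OF generates_tensor_power[OF V]] that by blast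
  note bN = bilinear_pure_tensor[OF N P, unfolded bilinear_map_def]
  have pt: "pure_tensor N ?P x t \<in> carrier ?T" if "x \<in> carrier N" "t \<in> carrier ?P" for x t
    using bN linear_mapD(1) that by fast
  {
    assume \<psi>: "\<psi> \<in> T"
    have l: "linear_map ?T (tree_tensor T N V n) (pure_tensor ?F ?T (Poly_Mapping.single \<psi> 1))"
      using bilinear_pure_tensor[OF F T] \<psi> by (simp add: bilinear_map_def tree_tensor_def)
    show "linear_map N (tree_tensor T N V n) (\<lambda>x. tree_gen T N V n \<psi> x a)" if a: "a \<in> tuples V n"
      unfolding tree_gen_def using linear_map_comp[OF _ l] bN pw[OF a] by blast
    assume x: "x \<in> carrier N"
    have "linear_map ?P ?T (pure_tensor N ?P x)" using bN x by blast
    from linear_map_comp[OF this l] 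
    have l': "linear_map ?P (tree_tensor T N V n) (\<lambda>t. pure_tensor ?F ?T (Poly_Mapping.single \<psi> 1) (pure_tensor N ?P x t))" .
    show "multilinear_map V n (tree_tensor T N V n) (tree_gen T N V n \<psi> x)"
      unfolding multilinear_map_def tree_gen_def
    proof (intro conjI ballI allI impI)
      show "(\<lambda>a. pure_tensor ?F ?T (Poly_Mapping.single \<psi> 1) (pure_tensor N ?P x (pure_power V n a)))
          \<in> tuples V n \<rightarrow> carrier (tree_tensor T N V n)"
        using linear_mapD(1)[OF l'] pw by blast
      fix a i assume "a \<in> tuples V n" "i < n"
      then have "linear_map V ?P (\<lambda>v. pure_power V n (a[i := v]))"
        using multilinear_pure_power[OF V, of n] by (simp add: multilinear_map_def)
      from linear_map_comp[OF this l'] show "linear_map V (tree_tensor T N V n) (\<lambda>v. pure_tensor ?F ?T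
          (Poly_Mapping.single \<psi> 1) (pure_tensor N ?P x (pure_power V n (a[i := v]))))" .
    qed
  }
  {
    assume U: "module type_ring (U :: ('k, 'u) module)"
      and Fm: "\<And>\<psi> x. \<psi> \<in> T \<Longrightarrow> x \<in> carrier N \<Longrightarrow> multilinear_map V n U (F \<psi> x)"
      and Fl: "\<And>\<psi> a. \<psi> \<in> T \<Longrightarrow> a \<in> tuples V n \<Longrightarrow> linear_map N U (\<lambda>x. F \<psi> x a)"
    interpret U: module type_ring U by fact
    have "\<exists>D. linear_map ?T U D \<and> (\<forall>x\<in>carrier N. \<forall>a\<in>tuples V n. D (pure_tensor N ?P x (pure_power V n a)) = F \<psi> x a)"
      if \<psi>: "\<psi> \<in> T" for \<psi>
    proof -
      have "\<forall>x\<in>carrier N. \<exists>g. linear_map ?P U g \<and> (\<forall>a\<in>tuples V n. g (pure_power V n a) = F \<psi> x a)"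
        using tensor_power_lift[OF V U Fm[OF \<psi>]] by blast
      then obtain g where g: "\<And>x. x \<in> carrier N \<Longrightarrow> linear_map ?P U (g x)"
        "\<And>x a. x \<in> carrier N \<Longrightarrow> a \<in> tuples V n \<Longrightarrow> g x (pure_power V n a) = F \<psi> x a"
        by metis
      \<comment> \<open>The maps \<open>g x\<close> were chosen separately for each
        \<open>x\<close>. Linearity in \<open>x\<close> is recovered because both sides are linear
        in \<open>t\<close> and agree on the generators of the tensor power.\<close>
      have "linear_map N U (\<lambda>x. g x t)" if t: "t \<in> carrier ?P" for t
        unfolding linear_map_def
      proof (intro conjI ballI allI)
        fix x y c assume x: "x \<in> carrier N" "y \<in> carrier N"
        show "g (x \<oplus>\<^bsub>N\<^esub> y) t = g x t \<oplus>\<^bsub>U\<^esub> g y t"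
          by (rule linear_map_eqI[OF P U g(1) linear_map_add_fun[OF U g(1) g(1)] generates_tensor_power[OF V] _ t])
            (use x linear_mapD(2)[OF Fl[OF \<psi>]] in \<open>auto simp: g(2)\<close>)
        show "g (c \<odot>\<^bsub>N\<^esub> x) t = c \<odot>\<^bsub>U\<^esub> g x t"
          by (rule linear_map_eqI[OF P U g(1) linear_map_smult[OF U g(1)] generates_tensor_power[OF V] _ t])
            (use x linear_mapD(3)[OF Fl[OF \<psi>]] in \<open>auto simp: g(2)\<close>)
      qed (use t linear_mapD(1)[OF g(1)] in auto)
      then have "bilinear_map N ?P U g" using g(1) by (simp add: bilinear_map_def)
      from tensor_lift[OF N P U this] show ?thesis using g(2) pw by auto
    qed
    then obtain D where D: "\<And>\<psi>. \<psi> \<in> T \<Longrightarrow> linear_map ?T U (D \<psi>)"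
      "\<And>\<psi> x a. \<psi> \<in> T \<Longrightarrow> x \<in> carrier N \<Longrightarrow> a \<in> tuples V n \<Longrightarrow> D \<psi> (pure_tensor N ?P x (pure_power V n a)) = F \<psi> x a"
      by metis
    \<comment> \<open>The separate maps \<open>D \<psi>\<close> are joined by linear extension along
      the basis of trees.\<close>
    have "bilinear_map ?F ?T U (\<lambda>p t. lin_ext U (\<lambda>\<psi>. D \<psi> t) p)"
      unfolding bilinear_map_def
    proof (intro conjI ballI)
      fix t assume "t \<in> carrier ?T"
      then show "linear_map ?F U (lin_ext U (\<lambda>\<psi>. D \<psi> t))"
        using linear_mapD(1)[OF D(1)] by (intro linear_lin_ext[OF U]) auto
    next
      fix p assume "p \<in> carrier ?F"
      then show "linear_map ?T U (\<lambda>t. lin_ext U (\<lambda>\<psi>. D \<psi> t) p)"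
        unfolding lin_ext_def using D(1)
        by (intro linear_map_finsum_fun[OF U] linear_map_smult[OF U]) auto
    qed
    from tensor_lift[OF F T U this] obtain f where f: "linear_map (tree_tensor T N V n) U f"
      "\<And>p t. p \<in> carrier ?F \<Longrightarrow> t \<in> carrier ?T \<Longrightarrow> f (pure_tensor ?F ?T p t) = lin_ext U (\<lambda>\<psi>. D \<psi> t) p"
      unfolding tree_tensor_def by blast
    have "f (tree_gen T N V n \<psi> x a) = F \<psi> x a"
      if \<psi>: "\<psi> \<in> T" and x: "x \<in> carrier N" and a: "a \<in> tuples V n" for \<psi> x a
    proof -
      let ?t = "pure_tensor N ?P x (pure_power V n a)"
      have t: "?t \<in> carrier ?T" by (rule pt[OF x pw[OF a]])
      have "f (tree_gen T N V n \<psi> x a) = lin_ext U (\<lambda>\<psi>. D \<psi> ?t) (Poly_Mapping.single \<psi> 1)"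
        unfolding tree_gen_def by (rule f(2)[OF _ t]) (simp add: \<psi>)
      also have "\<dots> = 1 \<odot>\<^bsub>U\<^esub> D \<psi> ?t"
        by (rule lin_ext_single[OF U, of "\<lambda>\<psi>. D \<psi> ?t"]) (rule linear_mapD(1)[OF D(1)[OF \<psi>] t])
      also have "\<dots> = D \<psi> ?t"
        using U.smult_one[OF linear_mapD(1)[OF D(1)[OF \<psi>] t]] by simp
      also have "\<dots> = F \<psi> x a" by (rule D(2)[OF \<psi> x a])
      finally show ?thesis .
    qed
    with f(1) show "\<exists>f. linear_map (tree_tensor T N V n) U f \<and>
        (\<forall>\<psi>\<in>T. \<forall>x\<in>carrier N. \<forall>a\<in>tuples V n. f (tree_gen T N V n \<psi> x a) = F \<psi> x a)"
      by blast
  }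
qed

section \<open>Relations in the enveloping algebra\<close>

lemma ideal_Idl: "ring R \<Longrightarrow> S \<subseteq> carrier R \<Longrightarrow> ideal (Idl\<^bsub>R\<^esub> S) R \<and> S \<subseteq> Idl\<^bsub>R\<^esub> S"
  by (simp add: ring.genideal_ideal ring.genideal_self)

lemma coset_eqI:
  assumes "ring R" "ideal I R" "x \<in> carrier R" "y \<in> carrier R" "x \<ominus>\<^bsub>R\<^esub> y \<in> I"
  shows "I +>\<^bsub>R\<^esub> x = I +>\<^bsub>R\<^esub> y"
  using ring.quotient_eq_iff_same_a_r_cos[OF assms(1-4)] assms(5) by simp

section \<open>The tensor algebra as a quotient of the free algebra on words\<close>

context
  fixes scale :: "'k::field \<Rightarrow> 'v::ab_group_add \<Rightarrow> 'v"
begin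

lemma tensor_algebra_ideal: "ideal (tensor_algebra_ideal scale) type_ring"
  unfolding tensor_algebra_ideal_def by (rule ideal_Idl[OF ring_type_ring, THEN conjunct1]) simp

lemma ring_tensor_algebra: "ring (tensor_algebra scale)"
  unfolding tensor_algebra_def by (rule ideal.quotient_is_ring[OF tensor_algebra_ideal])

definition tensor_algebra_proj :: "('v list \<Rightarrow>\<^sub>0 'k) \<Rightarrow> ('v list \<Rightarrow>\<^sub>0 'k) set" where
  "tensor_algebra_proj p = tensor_algebra_ideal scale +>\<^bsub>type_ring\<^esub> p"

lemma tensor_algebra_proj_hom: "tensor_algebra_proj \<in> ring_hom type_ring (tensor_algebra scale)"
  using ideal.rcos_ring_hom[OF tensor_algebra_ideal]
  by (simp add: tensor_algebra_def tensor_algebra_proj_def[abs_def])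

lemma tensor_algebra_proj_simps:
  "tensor_algebra_proj p \<in> carrier (tensor_algebra scale)"
  "tensor_algebra_proj (p * q) = tensor_algebra_proj p \<otimes>\<^bsub>tensor_algebra scale\<^esub> tensor_algebra_proj q"
  "tensor_algebra_proj (p + q) = tensor_algebra_proj p \<oplus>\<^bsub>tensor_algebra scale\<^esub> tensor_algebra_proj q"
  "tensor_algebra_proj 1 = \<one>\<^bsub>tensor_algebra scale\<^esub>"
  using ring_hom_closed[OF tensor_algebra_proj_hom, of p] ring_hom_mult[OF tensor_algebra_proj_hom, of p q]
    ring_hom_add[OF tensor_algebra_proj_hom, of p q] ring_hom_one[OF tensor_algebra_proj_hom] by auto

lemma tensor_algebra_proj_rel:
  "tensor_algebra_proj (Poly_Mapping.single [v + w] 1)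
    = tensor_algebra_proj (Poly_Mapping.single [v] 1 + Poly_Mapping.single [w] 1)"
  "tensor_algebra_proj (Poly_Mapping.single [scale c v] 1) = tensor_algebra_proj (Poly_Mapping.single [v] c)"
proof -
  let ?S = "{Poly_Mapping.single [v + w] 1
           - Poly_Mapping.single [v] 1 - Poly_Mapping.single [w] 1 | v w. True} \<union>
        {Poly_Mapping.single [scale c v] 1 - Poly_Mapping.single [v] c | c v. True}"
  have S: "?S \<subseteq> tensor_algebra_ideal scale"
    unfolding tensor_algebra_ideal_def using ideal_Idl[OF ring_type_ring, of ?S] by auto
  have eq: "tensor_algebra_proj x = tensor_algebra_proj y" if "x - y \<in> ?S" for x y
    unfolding tensor_algebra_proj_def
    by (rule coset_eqI[OF ring_type_ring tensor_algebra_ideal]) (use S that in \<open>auto simp: a_minus_def\<close>)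
  show "tensor_algebra_proj (Poly_Mapping.single [v + w] 1)
      = tensor_algebra_proj (Poly_Mapping.single [v] 1 + Poly_Mapping.single [w] 1)"
    by (rule eq) (force simp: diff_diff_eq)
  show "tensor_algebra_proj (Poly_Mapping.single [scale c v] 1) = tensor_algebra_proj (Poly_Mapping.single [v] c)"
    by (rule eq) blast
qed

lemma tensor_algebra_incl_proj: "tensor_algebra_incl scale v = tensor_algebra_proj (Poly_Mapping.single [v] 1)"
  and tensor_algebra_const_proj: "tensor_algebra_const scale c = tensor_algebra_proj (Poly_Mapping.single [] c)"
  by (simp_all add: tensor_algebra_incl_def tensor_algebra_const_def tensor_algebra_proj_def)

text \<open>A constant is a multiple of the empty word, the unit of the free monoid, so it commutes
  with the generators. This is what later makes the action of a generator linear over the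
  field.\<close>

lemma tensor_algebra_simps:
  "tensor_algebra_incl scale (v + w) = tensor_algebra_incl scale v \<oplus>\<^bsub>tensor_algebra scale\<^esub> tensor_algebra_incl scale w"
  "tensor_algebra_incl scale (scale c v) = tensor_algebra_const scale c \<otimes>\<^bsub>tensor_algebra scale\<^esub> tensor_algebra_incl scale v"
  "tensor_algebra_const scale c \<otimes>\<^bsub>tensor_algebra scale\<^esub> tensor_algebra_incl scale v
    = tensor_algebra_incl scale v \<otimes>\<^bsub>tensor_algebra scale\<^esub> tensor_algebra_const scale c"
  "tensor_algebra_const scale (c + d) = tensor_algebra_const scale c \<oplus>\<^bsub>tensor_algebra scale\<^esub> tensor_algebra_const scale d"
  "tensor_algebra_const scale (c * d) = tensor_algebra_const scale c \<otimes>\<^bsub>tensor_algebra scale\<^esub> tensor_algebra_const scale d"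
  "tensor_algebra_const scale 1 = \<one>\<^bsub>tensor_algebra scale\<^esub>"
  "tensor_algebra_incl scale v \<in> carrier (tensor_algebra scale)"
  "tensor_algebra_const scale c \<in> carrier (tensor_algebra scale)"
  unfolding tensor_algebra_incl_proj tensor_algebra_const_proj tensor_algebra_proj_rel
    tensor_algebra_proj_simps(3)[symmetric] tensor_algebra_proj_simps(2)[symmetric] tensor_algebra_proj_simps(4)[symmetric]
  by (simp_all add: tensor_algebra_proj_simps(1) mult_single single_add plus_list_def)
    (simp flip: zero_list_def)

end

section \<open>The defining relations inside the enveloping algebra\<close>

context triassociative_algebra
begin

lemma TA_gen_closed: "TA_gen s a \<in> carrier TA"
  by (simp add: TA_gen_def TA_def tensor_algebra_simps)

lemma ring_TA: "ring TA"
  by (simp add: TA_def ring_tensor_algebra)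

lemma UA_rel_closed: "UA_rel u v \<Longrightarrow> u \<in> carrier TA \<and> v \<in> carrier TA"
  by (induction rule: UA_rel.induct) (auto intro: TA_gen_closed ring.ring_simprules[OF ring_TA])

lemma UA_ideal: "ideal UA_ideal TA" and UA_ideal_rel: "UA_rel u v \<Longrightarrow> u \<ominus>\<^bsub>TA\<^esub> v \<in> UA_ideal"
proof -
  let ?S = "{u \<ominus>\<^bsub>TA\<^esub> v | u v. UA_rel u v}"
  have "?S \<subseteq> carrier TA"
    using UA_rel_closed ring.ring_simprules(4)[OF ring_TA] by blast
  from ideal_Idl[OF ring_TA this]
  show "ideal UA_ideal TA" "UA_rel u v \<Longrightarrow> u \<ominus>\<^bsub>TA\<^esub> v \<in> UA_ideal"
    unfolding UA_ideal_def by blast+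
qed

lemma UA_rel_eq: "UA_rel u v \<Longrightarrow> UA_ideal +>\<^bsub>TA\<^esub> u = UA_ideal +>\<^bsub>TA\<^esub> v"
  by (rule coset_eqI[OF ring_TA UA_ideal]) (auto simp: UA_rel_closed UA_ideal_rel)

lemma UA_proj_hom: "(+>\<^bsub>TA\<^esub>) UA_ideal \<in> ring_hom TA UA"
  unfolding UA_def by (rule ideal.rcos_ring_hom[OF UA_ideal])

lemma UA_simps:
  shows UA_gen_closed: "UA_gen s a \<in> carrier UA"
    and UA_const_closed: "UA_const c \<in> carrier UA"
    and UA_gen_add: "UA_gen s (a + b) = UA_gen s a \<oplus>\<^bsub>UA\<^esub> UA_gen s b"
    and UA_gen_scale: "UA_gen s (scale c a) = UA_const c \<otimes>\<^bsub>UA\<^esub> UA_gen s a"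
    and UA_const_central: "UA_const c \<otimes>\<^bsub>UA\<^esub> UA_gen s a = UA_gen s a \<otimes>\<^bsub>UA\<^esub> UA_const c"
    and UA_const_add: "UA_const (c + d) = UA_const c \<oplus>\<^bsub>UA\<^esub> UA_const d"
    and UA_const_mult: "UA_const (c * d) = UA_const c \<otimes>\<^bsub>UA\<^esub> UA_const d"
    and UA_const_one: "UA_const 1 = \<one>\<^bsub>UA\<^esub>"
proof -
  note T = tensor_algebra_simps[of sum_scale, folded TA_def]
  note h = ring_hom_closed[OF UA_proj_hom] ring_hom_mult[OF UA_proj_hom, symmetric]
    ring_hom_add[OF UA_proj_hom, symmetric] ring_hom_one[OF UA_proj_hom, symmetric]
  let ?e = "\<lambda>a s'. if s' = s then a else (0::'a)"
  have add: "?e (a + b) = ?e a + ?e b" by auto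
  have scale: "?e (scale c a) = sum_scale c (?e a)" by (auto simp: sum_scale_def)
  show "UA_gen s a \<in> carrier UA" "UA_const c \<in> carrier UA"
    "UA_gen s (a + b) = UA_gen s a \<oplus>\<^bsub>UA\<^esub> UA_gen s b"
    "UA_gen s (scale c a) = UA_const c \<otimes>\<^bsub>UA\<^esub> UA_gen s a"
    "UA_const c \<otimes>\<^bsub>UA\<^esub> UA_gen s a = UA_gen s a \<otimes>\<^bsub>UA\<^esub> UA_const c"
    "UA_const (c + d) = UA_const c \<oplus>\<^bsub>UA\<^esub> UA_const d"
    "UA_const (c * d) = UA_const c \<otimes>\<^bsub>UA\<^esub> UA_const d"
    "UA_const 1 = \<one>\<^bsub>UA\<^esub>"
    unfolding UA_gen_def UA_const_def TA_gen_def add scale by (simp_all add: T h)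
qed

lemma UA_gen_mult: "UA_ideal +>\<^bsub>TA\<^esub> (TA_gen s a \<otimes>\<^bsub>TA\<^esub> TA_gen t b) = UA_gen s a \<otimes>\<^bsub>UA\<^esub> UA_gen t b"
  unfolding UA_gen_def by (rule ring_hom_mult[OF UA_proj_hom TA_gen_closed TA_gen_closed])

text \<open>The introduction rules are listed in the order of the relations, so the
  \<open>k\<close>-th fact is relation (k) and later selections can be read by number.\<close>

lemmas UA_relations = UA_rel.intros[THEN UA_rel_eq, unfolded UA_gen_mult, folded UA_gen_def]

end

section \<open>Height labellings of trees\<close>

definition cmp :: "int \<Rightarrow> int \<Rightarrow> orientation" where
  "cmp p q = (if p < q then LeftOriented else if q < p then RightOriented else Middle)"

text \<open>The effect of the \<open>i\<close>th face on a word. On words of integers with \<open>f = min\<close> it describes the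
  deletion of a leaf.\<close>

definition contract :: "('b \<Rightarrow> 'b \<Rightarrow> 'b) \<Rightarrow> nat \<Rightarrow> 'b list \<Rightarrow> 'b list" where
  "contract f i w =
     (if i = 0 then tl w
      else if i < length w then take (i - 1) w @ f (w ! (i - 1)) (w ! i) # drop (i + 1) w
      else butlast w)"

lemma length_contract [simp]: "length (contract f i w) = length w - 1"
  by (auto simp: contract_def)

text \<open>One formula covers the outer faces too: \<open>i = 0\<close> always falls into the last
  branch and \<open>i \<ge> length w\<close> always into the first. Words are compared entrywise
  below for this reason.\<close>

lemma nth_contract:
  assumes "Suc k < length w"
  shows "contract f i w ! k =
    (if Suc k < i then w ! k else if Suc k = i then f (w ! k) (w ! Suc k) else w ! Suc k)"
  using assms
  by (auto simp: contract_def nth_append nth_tl nth_butlast min_def nth_Cons split: nat.split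
      intro!: arg_cong[of _ _ "(!) w"])

text \<open>The identities of a bar construction. Associativity is used only when
  \<open>j = i + 1\<close>, at the entry where three neighbours are merged.\<close>

lemma contract_contract:
  assumes assoc: "\<And>u v w. f (f u v) w = f u (f v w)" and "i < j" "j \<le> length w" "2 \<le> length w"
  shows "contract f i (contract f j w) = contract f (j - 1) (contract f i w)"
proof (rule nth_equalityI)
  fix k assume "k < length (contract f i (contract f j w))"
  then have k: "Suc (Suc k) < length w" by simp
  show "contract f i (contract f j w) ! k = contract f (j - 1) (contract f i w) ! k"
    using k assms by (auto simp: nth_contract)
qed simp

lemma map_contract:
  assumes "i \<le> length w" "\<And>u v. h (f u v) = g (h u) (h v)"
  shows "map h (contract f i w) = contract g i (map h w)"
  using assms by (auto simp: contract_def map_tl map_butlast take_map drop_map)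

text \<open>Contraction can reach across the separating \<open>m\<close> at two places, and there
  the minimum is \<open>m\<close> itself. So the effect is \<open>butlast\<close> on
  \<open>d1\<close> or \<open>tl\<close> on \<open>d2\<close>, which is what the outer contractions
  of these words do.\<close>

lemma contract_min_append:
  fixes m :: int
  assumes d1: "\<forall>x\<in>set d1. m < x" and d2: "\<forall>x\<in>set d2. m \<le> x" and i: "i \<le> length d1 + 1 + length d2"
  shows "i \<le> length d1 \<Longrightarrow> d1 \<noteq> [] \<Longrightarrow> contract min i (d1 @ m # d2) = contract min i d1 @ m # d2"
    and "length d1 < i \<Longrightarrow> d2 \<noteq> [] \<Longrightarrow>
      contract min i (d1 @ m # d2) = d1 @ m # contract min (i - length d1 - 1) d2"
proof -
  assume a: "i \<le> length d1" "d1 \<noteq> []"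
  show "contract min i (d1 @ m # d2) = contract min i d1 @ m # d2"
  proof (rule nth_equalityI)
    fix k assume "k < length (contract min i (d1 @ m # d2))"
    then have k: "Suc k < length (d1 @ m # d2)" by simp
    obtain n where n: "length d1 = Suc n" using a by (cases d1) auto
    have m: "min (d1 ! n) m = m" using d1 n by (metis lessI min.absorb2 nth_mem order_less_imp_le)
    consider "k < n" | "k = n" | l where "k = Suc (n + l)"
      using less_imp_Suc_add nat_neq_iff by metis
    then show "contract min i (d1 @ m # d2) ! k = (contract min i d1 @ m # d2) ! k"
      by cases (use k a m n in \<open>auto simp: nth_contract nth_append\<close>)
  qed (use a in \<open>cases d1; simp\<close>)
next
  assume a: "length d1 < i" "d2 \<noteq> []"
  show "contract min i (d1 @ m # d2) = d1 @ m # contract min (i - length d1 - 1) d2"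
  proof (rule nth_equalityI)
    fix k assume "k < length (contract min i (d1 @ m # d2))"
    then have k: "Suc k < length (d1 @ m # d2)" by simp
    have m: "min m (d2 ! 0) = m" using d2 a by (cases d2) auto
    consider "k < length d1" | "k = length d1" | l where "k = Suc (length d1 + l)" "Suc l < length d2"
      using k by (metis Suc_lessI add_Suc_right length_Cons length_append less_imp_Suc_add nat_add_left_cancel_less not_less_eq not_less_iff_gr_or_eq)
    then show "contract min i (d1 @ m # d2) ! k = (d1 @ m # contract min (i - length d1 - 1) d2) ! k"
      by cases (use k a m in \<open>auto simp: nth_contract nth_append nth_Cons split: nat.split\<close>)
  qed (use a in \<open>cases d2; simp\<close>)
qed

text \<open>
  \<open>lab \<psi> d\<close>: the list \<open>d\<close> assigns to the gap between the leaves \<open>i - 1\<close> and \<open>i\<close> a height \<open>d ! (i - 1)\<close>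
  of the vertex where the two leaves meet. Heights only have to increase away from the root, so
  that suppressing a vertex leaves the remaining heights valid.
\<close>

inductive lab :: "ptree \<Rightarrow> int list \<Rightarrow> bool"
  and lab_forest :: "int \<Rightarrow> ptree list \<Rightarrow> int list \<Rightarrow> bool" where
  lab_Leaf: "lab Leaf []"
| lab_Node: "lab_forest m ts d \<Longrightarrow> 2 \<le> length ts \<Longrightarrow> lab (Node ts) d"
| lab_single: "lab t d \<Longrightarrow> \<forall>x\<in>set d. m < x \<Longrightarrow> lab_forest m [t] d"
| lab_Cons: "lab t d1 \<Longrightarrow> \<forall>x\<in>set d1. m < x \<Longrightarrow> lab_forest m ts d2 \<Longrightarrow> lab_forest m (t # ts) (d1 @ m # d2)"

lemma lab_proper:
  "lab t d \<Longrightarrow> proper t \<and> num_leaves t = length d + 1"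
  "lab_forest m ts d \<Longrightarrow> (\<forall>t\<in>set ts. proper t) \<and> ts \<noteq> [] \<and> sum_list (map num_leaves ts) = length d + 1
     \<and> (\<forall>x\<in>set d. m \<le> x)"
  by (induction rule: lab_lab_forest.inducts) auto

inductive_cases lab_LeafE: "lab Leaf d"
inductive_cases lab_NodeE: "lab (Node ts) d"
inductive_cases lab_forest_singleE: "lab_forest m [t] d"

lemma lab_Leaf_iff: "lab Leaf d \<longleftrightarrow> d = []"
  by (auto elim: lab_LeafE intro: lab_Leaf)

lemma lab_Nil: "lab t [] \<Longrightarrow> t = Leaf"
proof (cases t)
  case (Node ts)
  assume "lab t []"
  then obtain m where "lab_forest m ts []" "2 \<le> length ts" using Node by (auto elim: lab_NodeE)
  then show ?thesis by cases auto
qed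

text \<open>The lower bound \<open>m\<close> is arbitrary for the sake of the induction: the root
  gets height \<open>m + 1\<close>, and the subtrees are labelled above that.\<close>

lemma ex_lab:
  "proper t \<Longrightarrow> \<exists>d. lab t d \<and> (\<forall>x\<in>set d. m < x)"
proof (induction t arbitrary: m)
  case (Node ts)
  have "\<exists>d. lab_forest (m+1) us d" if "set us \<subseteq> set ts" "us \<noteq> []" for us
    using that(2,1)
  proof (induction us rule: list_nonempty_induct)
    case (single t)
    then show ?case using Node by (metis insert_subset lab_single list.simps(15) proper.simps(2))
  next
    case (cons t us)
    then show ?case using Node by (metis insert_subset lab_Cons list.simps(15) proper.simps(2))
  qed
  then obtain d where d: "lab_forest (m+1) ts d" using Node(2) by (metis length_greater_0_conv order_less_le_trans order_refl proper.simps(2) zero_less_numeral)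
  then have "lab (Node ts) d" using Node(2) by (auto intro: lab_Node)
  moreover have "\<forall>x\<in>set d. m < x" using lab_proper(2)[OF d] by auto
  ultimately show ?case by blast
qed (auto intro: lab_Leaf)

text \<open>A single remaining tree keeps its labels; only the bound by the height of the suppressed
  vertex is forgotten.\<close>

lemma lab_join: "lab_forest m ts d \<Longrightarrow> lab (join ts) d"
proof (cases ts rule: join.cases)
  case (1 t)
  assume "lab_forest m ts d" then show ?thesis using 1 by cases (auto dest: lab_proper(2))
qed (auto intro: lab_Node dest: lab_proper(2))

lemma set_contract_min: "set (contract min i d) \<subseteq> set (d :: int list)"
  by (auto simp: contract_def min_def dest: in_set_takeD in_set_dropD in_set_butlastD list.set_sel(2)
       split: if_splits)

lemma contract_Cons_0: "contract f 0 (a # d) = d"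
  by (simp add: contract_def)

lemma contract_last: "length d = i \<Longrightarrow> d \<noteq> [] \<Longrightarrow> contract f i d = butlast d"
  by (auto simp: contract_def)

text \<open>Inside a subtree both merged labels exceed \<open>m\<close>, and next to a gap of height
  \<open>m\<close> their minimum is \<open>m\<close>, so the word stays legal. The forest
  \<open>[Leaf]\<close> is exceptional because its deletion leaves the empty forest, which has no
  labelling.\<close>

lemma lab_delete:
  "lab t d \<Longrightarrow> i \<le> length d \<Longrightarrow> d \<noteq> [] \<Longrightarrow> lab (delete_leaf i t) (contract min i d)"
  "lab_forest m ts d \<Longrightarrow> i \<le> length d \<Longrightarrow>
     (if ts = [Leaf] then delete_forest i ts = []
      else lab_forest m (delete_forest i ts) (contract min i d))"
proof (induction arbitrary: i and i rule: lab_lab_forest.inducts)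
  case (lab_Node m ts d)
  then have "ts \<noteq> [Leaf]" by auto
  with lab_Node show ?case by (auto intro: lab_join)
next
  case (lab_single t d m)
  show ?case
  proof (cases t)
    case (Node us)
    then have "d \<noteq> []" using lab_single lab_Nil by blast
    with lab_single have "lab (delete_leaf i t) (contract min i d)" by auto
    moreover have "\<forall>x\<in>set (contract min i d). m < x" using lab_single set_contract_min by blast
    moreover have "i < sum_list (map num_leaves us)" using lab_proper(1)[OF lab_single(1)] lab_single Node by auto
    ultimately show ?thesis using Node by (auto intro: lab_lab_forest.lab_single)
  qed (use lab_single in \<open>simp add: lab_Leaf_iff\<close>)
next
  case (lab_Cons t d1 m ts d2)
    note t = lab_Cons.hyps(1) and d1m = lab_Cons.hyps(2) and ts = lab_Cons.hyps(3)
  have d2: "\<forall>x\<in>set d2. m \<le> x" "ts \<noteq> []" using lab_proper(2)[OF ts] by auto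
  have i: "i \<le> length d1 + 1 + length d2" using lab_Cons.prems by simp
  note c = contract_min_append[OF d1m d2(1) i]
  \<comment> \<open>Leaves to the right of the first subtree, whatever that subtree is. If the only
    sibling is a leaf, it disappears together with the gap \<open>m\<close>, and \<open>t\<close>
    remains as a forest of one tree with word \<open>d1\<close>.\<close>
  have tail: "lab_forest m (t # delete_forest (i - length d1 - 1) ts) (contract min i (d1 @ m # d2))"
    if li: "length d1 < i"
  proof (cases "ts = [Leaf]")
    case True
    have "d2 = []" using lab_proper(2)[OF ts] True by simp
    moreover from this have "contract min i (d1 @ [m]) = d1" using li i by (subst contract_last) auto
    ultimately show ?thesis using True t d1m li i by (simp add: lab_single)
  next
    case False
    then have "lab_forest m (delete_forest (i - length d1 - 1) ts) (contract min (i - length d1 - 1) d2)"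
      using lab_Cons.IH(2)[of "i - length d1 - 1"] i by simp
    moreover have "d2 \<noteq> []"
    proof
      assume "d2 = []"
      with ts have "lab_forest m ts []" by simp
      then show False by cases (use False lab_Nil in auto)
    qed
    ultimately show ?thesis using c(2)[OF li] t d1m lab_lab_forest.lab_Cons by simp
  qed
  show ?case
  proof (cases t)
    case Leaf
    then have "d1 = []" using t by (simp add: lab_Leaf_iff)
    then show ?thesis using Leaf ts d2 tail by (cases "i = 0") (simp_all add: contract_Cons_0)
  next
    case (Node us)
    have n: "num_leaves t = length d1 + 1" using lab_proper(1)[OF t] by blast
    have d1: "d1 \<noteq> []" using Node t lab_Nil by blast
    show ?thesis
    proof (cases "i \<le> length d1")
      case True
      then have "lab (delete_leaf i t) (contract min i d1)" using lab_Cons.IH(1) d1 by blast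
      moreover have "\<forall>x\<in>set (contract min i d1). m < x" using d1m set_contract_min by blast
      ultimately have "lab_forest m (delete_leaf i t # ts) (contract min i d1 @ m # d2)"
        using ts by (rule lab_lab_forest.lab_Cons)
      then show ?thesis using c(1)[OF True d1] n True Node by simp
    next
      case False
      then show ?thesis using tail n Node by simp
    qed
  qed
qed (auto intro: lab_Leaf)

lemma lab_forest_mem: "lab_forest m ts d \<Longrightarrow> 2 \<le> length ts \<Longrightarrow> m \<in> set d"
  by (cases rule: lab_forest.cases) auto

text \<open>At a node with at least two subtrees the root height is the minimum of the word, hence
  determined by it. The first occurrence of that height ends the word of the first subtree, whose
  labels are all larger.\<close>

lemma lab_unique:
  "lab t d \<Longrightarrow> lab t' d \<Longrightarrow> t = t'"
  "lab_forest m ts d \<Longrightarrow> lab_forest m ts' d \<Longrightarrow> ts = ts'"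
proof (induction arbitrary: t' and ts' rule: lab_lab_forest.inducts)
  case lab_Leaf
  then show ?case using lab_Nil by blast
next
  case (lab_Node m ts d)
  then have "m \<in> set d" "\<forall>x\<in>set d. m \<le> x" using lab_forest_mem lab_proper(2) by blast+
  moreover from this obtain ts' where t': "t' = Node ts'" using lab_Node.prems lab_Leaf_iff by (cases t') auto
  moreover obtain m' where m': "lab_forest m' ts' d" "2 \<le> length ts'" using lab_Node.prems t' lab_NodeE by blast
  moreover from this have "m' \<in> set d" "\<forall>x\<in>set d. m' \<le> x" using lab_forest_mem lab_proper(2) by blast+
  ultimately have "m = m'" by (meson order_antisym)
  then show ?case using lab_Node m' t' by blast
next
  case (lab_single t d m)
  from lab_single.prems show ?case
  proof cases
    case (lab_single t')
    then show ?thesis using \<open>\<And>t'. lab t' d \<Longrightarrow> t = t'\<close> by simp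
  next
    case (lab_Cons t' e1 us e2)
    then show ?thesis using \<open>\<forall>x\<in>set d. m < x\<close> by simp
  qed
next
  case (lab_Cons t d1 m ts d2)
  have a: "m \<notin> set d1" using \<open>\<forall>x\<in>set d1. m < x\<close> by blast
  note IH = \<open>\<And>t'. lab t' d1 \<Longrightarrow> t = t'\<close> \<open>\<And>ts'. lab_forest m ts' d2 \<Longrightarrow> ts = ts'\<close>
  from lab_Cons.prems show ?case
  proof cases
    case (lab_single t')
    then show ?thesis by simp
  next
    case (lab_Cons t' e1 us e2)
    then have "m \<notin> set e1" by blast
    with a lab_Cons(2) have "d1 = e1 \<and> d2 = e2"
      by (auto simp: append_eq_append_conv2 append_eq_Cons_conv Cons_eq_append_conv)
    then show ?thesis using lab_Cons IH by simp
  qed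
qed

text \<open>\<open>x\<close> and \<open>y\<close> are heights for the gaps to the left and right of the whole forest: the gap on the
  right, and on the left if the forest is leftmost, belongs to a vertex closer to the root.\<close>

lemma orient_forest_lab:
  "lab_forest m ts d \<Longrightarrow> (if b then x < m \<and> 2 \<le> length ts else x = m) \<Longrightarrow> y < m \<Longrightarrow> i \<le> length d \<Longrightarrow>
    orient_forest b i ts = cmp ((x # d @ [y]) ! i) ((d @ [y]) ! i)"
proof (induction b i ts arbitrary: m d x y rule: orient_forest.induct)
  case (1 b i)
  then show ?case using lab_proper(2) by blast
next
  case (2 b i ts)
  from 2(2) show ?case
  proof cases
    case lab_single
    then show ?thesis using 2(3-) by (auto simp: cmp_def lab_Leaf_iff split: if_splits)
  next
    case (lab_Cons d1 d2)
    then have d: "d = m # d2" by (simp add: lab_Leaf_iff)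
    have "ts \<noteq> []" using lab_Cons lab_proper(2) by blast
    show ?thesis
    proof (cases "i = 0")
      case True
      then show ?thesis using 2(3) d \<open>ts \<noteq> []\<close> by (auto simp: cmp_def split: if_splits)
    next
      case False
      have "orient_forest False (i - 1) ts = cmp ((m # d2 @ [y]) ! (i - 1)) ((d2 @ [y]) ! (i - 1))"
        by (rule 2(1)) (use False 2 lab_Cons d in auto)
      then show ?thesis using False d by (cases i) auto
    qed
  qed
next
  case (3 b i us ts)
  \<comment> \<open>Descent into a subtree: \<open>z\<close> is the height of the gap to its right,
    which is \<open>m\<close> if a sibling follows and \<open>y\<close> otherwise. The root of the
    subtree is strictly higher than \<open>m\<close>, so the recursive call starts with the flag
    \<open>True\<close>.\<close>
  have us: "orient_forest True i us = cmp ((x # d1 @ [z]) ! i) ((d1 @ [z]) ! i)"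
    if a: "lab (Node us) d1" and "\<forall>x\<in>set d1. m < x" "z \<le> m" "i \<le> length d1" for d1 z
  proof -
    obtain m' where m': "lab_forest m' us d1" "2 \<le> length us"
      using a by (rule lab_NodeE) blast
    have "m' \<in> set d1" using lab_forest_mem[OF m'] .
    then have "m < m'" using that(2) by blast
    moreover have "num_leaves (Node us) = length d1 + 1" using lab_proper(1)[OF that(1)] by blast
    ultimately show ?thesis using that m' 3(4) by (intro 3(1)[of m']) (auto split: if_splits)
  qed
  from 3(3) show ?case
  proof cases
    case lab_single
    have "num_leaves (Node us) = length d + 1" using lab_proper(1) lab_single by blast
    then show ?thesis using us[of d y] 3(5,6) lab_single by auto
  next
    case (lab_Cons d1 d2)
    have n: "num_leaves (Node us) = length d1 + 1" using lab_proper(1) lab_Cons by blast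
    show ?thesis
    proof (cases "i \<le> length d1")
      case True
      then have "orient_forest b i (Node us # ts) = orient_forest True i us" using n by simp
      also have "\<dots> = cmp ((x # d1 @ [m]) ! i) ((d1 @ [m]) ! i)"
        using us lab_Cons True by blast
      also have "\<dots> = cmp ((x # d @ [y]) ! i) ((d @ [y]) ! i)"
        using True lab_Cons by (cases i) (auto simp: nth_append)
      finally show ?thesis .
    next
      case False
      let ?j = "i - num_leaves (Node us)"
      have i: "i = Suc (length d1 + ?j)" using False n by simp
      have "orient_forest b i (Node us # ts) = orient_forest False ?j ts" using n False by simp
      also have "\<dots> = cmp ((m # d2 @ [y]) ! ?j) ((d2 @ [y]) ! ?j)"
        by (rule 3(2)) (use False 3(5,6) lab_Cons n i in auto)
      also have "\<dots> = cmp ((x # d @ [y]) ! i) ((d @ [y]) ! i)"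
        unfolding lab_Cons by (subst (3 4) i) (simp add: nth_append del: num_leaves.simps)
      finally show ?thesis .
    qed
  qed
qed

lemma orient_lab:
  assumes "lab t d" "0 < i" "i < length d"
  shows "orient i t = cmp (d ! (i - 1)) (d ! i)"
proof -
  obtain m ts where m: "t = Node ts" "lab_forest m ts d" "2 \<le> length ts"
    using assms by cases auto
  \<comment> \<open>For an inner leaf both lookups fall inside \<open>d\<close>; the two outer
    heights \<open>m - 1\<close> only have to lie below the root.\<close>
  show ?thesis
    using orient_forest_lab[OF m(2), of True "m - 1" "m - 1" i] assms m
    by (cases i) (simp_all add: nth_append)
qed

text \<open>If the first gap is strictly lowest, the first leaf hangs at a binary root; if it is
  lowest but tied, the root has more branches; if some gap is lower, the first leaf lies in a
  subtree of positive degree. A word of one label gives \<open>AlphaL\<close>.\<close>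

definition first_cmp :: "int list \<Rightarrow> copy" where
  "first_cmp d =
    (if \<forall>y\<in>set (tl d). hd d < y then AlphaL else if \<forall>y\<in>set (tl d). hd d \<le> y then AlphaM else AlphaR)"

definition last_cmp :: "int list \<Rightarrow> copy" where
  "last_cmp d =
    (if \<forall>y\<in>set (butlast d). last d < y then BetaR
     else if \<forall>y\<in>set (butlast d). last d \<le> y then BetaM else BetaL)"

lemma lab_tree_deg: "lab t d \<Longrightarrow> tree_deg t = length d"
  using lab_proper(1) by (simp add: tree_deg_def)

text \<open>Every further tree contributes a gap of height exactly \<open>m\<close>. Applied to the
  forest that remains after removing an outermost subtree, this detects whether the root is
  binary.\<close>

lemma lab_forest_length2:
  assumes "lab_forest m ts d"
  shows "length ts = 1 \<longleftrightarrow> (\<forall>y\<in>set d. m < y)"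
  using assms
proof cases
  case (lab_Cons t d1 ts d2)
  then show ?thesis using lab_proper(2)[OF lab_Cons(5)] by auto
qed auto

lemma first_copy_lab:
  assumes "lab t d" "d \<noteq> []"
  shows "first_copy t = first_cmp d"
proof -
  obtain m ts where m: "t = Node ts" "lab_forest m ts d" "2 \<le> length ts"
    using assms by cases auto
  from m(2) obtain t' d1 ts' d2 where t': "ts = t' # ts'" "d = d1 @ m # d2" "lab t' d1"
    "\<forall>x\<in>set d1. m < x" "lab_forest m ts' d2"
    by cases (use m(3) in auto)
  have "\<forall>x\<in>set d2. m \<le> x" using lab_proper(2) t'(5) by blast
  then show ?thesis
    using m(1) t' lab_tree_deg[OF t'(3)] lab_forest_length2[OF t'(5)]
    by (cases d1) (auto simp: first_cmp_def)
qed

text \<open>Labelled forests are built from the left, while the last face needs the rightmost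
  subtree split off.\<close>

lemma lab_forest_rev:
  assumes "lab_forest m ts d" "2 \<le> length ts"
  shows "\<exists>ts' t d1 d2. ts = ts' @ [t] \<and> d = d1 @ m # d2 \<and> lab_forest m ts' d1 \<and> lab t d2 \<and> (\<forall>x\<in>set d2. m < x)"
  using assms
proof (induction ts arbitrary: d)
  case (Cons t ts)
  from Cons.prems(1) show ?case
  proof cases
    case (lab_Cons d1 d2)
    show ?thesis
    proof (cases "length ts = 1")
      case True
      then obtain t' where "ts = [t']" by (auto simp: length_Suc_conv)
      moreover from this have "lab t' d2 \<and> (\<forall>x\<in>set d2. m < x)"
        using lab_Cons(4) by (auto elim: lab_forest_singleE dest: lab_proper(2))
      ultimately show ?thesis using lab_Cons lab_single
        by (metis append_Cons append_Nil)
    next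
      case False
      then have "2 \<le> length ts" using Cons.prems by auto
      then obtain ts' t' e1 e2 where "ts = ts' @ [t']" "d2 = e1 @ m # e2" "lab_forest m ts' e1" "lab t' e2"
        "\<forall>x\<in>set e2. m < x" using Cons.IH[OF lab_Cons(4)] by blast
      then show ?thesis using lab_Cons lab_lab_forest.lab_Cons[of t d1 m ts' e1]
        by (intro exI[of _ "t # ts'"] exI[of _ t'] exI[of _ "d1 @ m # e1"] exI[of _ e2]) auto
    qed
  qed (use Cons.prems in auto)
qed simp

lemma last_copy_lab:
  assumes "lab t d" "d \<noteq> []"
  shows "last_copy t = last_cmp d"
proof -
  obtain m ts where m: "t = Node ts" "lab_forest m ts d" "2 \<le> length ts"
    using assms by cases auto
  then obtain t' d1 ts' d2 where t': "ts = ts' @ [t']" "d = d1 @ m # d2" "lab t' d2"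
    "\<forall>x\<in>set d2. m < x" "lab_forest m ts' d1"
    using lab_forest_rev by blast
  have "\<forall>x\<in>set d1. m \<le> x" using lab_proper(2) t'(5) by blast
  then show ?thesis
    using m(1) t' lab_tree_deg[OF t'(3)] lab_forest_length2[OF t'(5)]
    by (cases d2 rule: rev_cases) (auto simp: last_cmp_def butlast_append)
qed

section \<open>Labelled words\<close>

text \<open>Meant for lower bounds and \<open>f = min\<close>: inner contractions of the other
  labels do not change how an outermost label compares with them.\<close>

lemma ball_contract:
  assumes "0 < k" "k < length r" "\<And>u v. P (f u v) \<longleftrightarrow> P u \<and> P v"
  shows "(\<forall>y\<in>set (contract f k r). P y) \<longleftrightarrow> (\<forall>y\<in>set r. P y)"
proof -
  have "r = take (k - 1) r @ r ! (k - 1) # r ! k # drop (k + 1) r"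
    using assms(1,2) by (metis Cons_nth_drop_Suc Suc_diff_1 Suc_eq_plus1 append_take_drop_id less_imp_diff_less)
  then have "set r = set (take (k - 1) r @ r ! (k - 1) # r ! k # drop (k + 1) r)" by simp
  then show ?thesis using assms by (auto simp: contract_def)
qed

lemma contract_Cons:
  assumes "1 < j" "j \<le> length r"
  shows "contract f j (p # r) = p # contract f (j - 1) r"
  using assms by (intro nth_equalityI) (auto simp: nth_contract nth_Cons split: nat.split)

lemma contract_snoc:
  assumes "i < length r"
  shows "contract f i (r @ [p]) = contract f i r @ [p]"
proof (rule nth_equalityI)
  show "length (contract f i (r @ [p])) = length (contract f i r @ [p])" using assms by simp
  fix k assume "k < length (contract f i (r @ [p]))"
  then show "contract f i (r @ [p]) ! k = (contract f i r @ [p]) ! k"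
    using assms by (cases "Suc k < length r") (auto simp: nth_contract nth_append dest: less_antisym)
qed

lemma first_cmp_contract:
  assumes "1 < j" "j < length d"
  shows "first_cmp (contract min j d) = first_cmp d"
proof -
  obtain p r where d: "d = p # r" using assms by (cases d) auto
  have "(\<forall>y\<in>set (contract min (j - 1) r). P y) \<longleftrightarrow> (\<forall>y\<in>set r. P y)" 
    if "P = (\<lambda>y. p < y) \<or> P = (\<lambda>y. p \<le> y)" for P
    using assms d that by (intro ball_contract) auto
  then show ?thesis using assms d by (simp add: contract_Cons first_cmp_def)
qed

lemma last_cmp_contract:
  assumes "0 < i" "Suc i < length d"
  shows "last_cmp (contract min i d) = last_cmp d"
proof -
  obtain p r where d: "d = r @ [p]" using assms by (cases d rule: rev_cases) auto
  have "(\<forall>y\<in>set (contract min i r). P y) \<longleftrightarrow> (\<forall>y\<in>set r. P y)" 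
    if "P = (\<lambda>y. p < y) \<or> P = (\<lambda>y. p \<le> y)" for P
    using assms d that by (intro ball_contract) auto
  then show ?thesis using assms d by (simp add: contract_snoc last_cmp_def)
qed

section \<open>The product of labelled letters and the three groups of relations\<close>

context triassociative_algebra
begin

definition labelled_mult :: "int \<times> 'a \<Rightarrow> int \<times> 'a \<Rightarrow> int \<times> 'a" where
  "labelled_mult = (\<lambda>(p, a) (q, b).
     (min p q, if p < q then a \<stileturn> b else if q < p then a \<turnstile> b else a \<bottom> b))"

text \<open>Three labels have 13 weak orderings. Axiom (3) serves the three in which the middle
  label is strictly lowest, and each of the ten other axioms serves exactly one.\<close>

lemma labelled_mult_assoc: "labelled_mult (labelled_mult u v) w = labelled_mult u (labelled_mult v w)"
proof (cases u; cases v; cases w)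
  fix p a q b r c assume [simp]: "u = (p, a)" "v = (q, b)" "w = (r, c)"
  show ?thesis
    using trias1 trias2 trias3 trias4 trias5 trias6 trias7 trias8 trias9 trias10 trias11
    by (auto simp: labelled_mult_def min_def)
qed

lemma fst_labelled_mult: "fst (labelled_mult u v) = min (fst u) (fst v)"
  by (simp add: labelled_mult_def split: prod.split)

text \<open>The 33 relations fall into three groups of eleven, one for each kind of identity between
  faces in which both composites act on \<open>N\<close>, or one acts twice and the other
  once.\<close>

lemmas alpha_alpha = UA_relations(7-9,16-18,21,24,27,30,33)
lemmas beta_beta = UA_relations(1-3,10-12,19,22,25,28,31)
lemmas beta_alpha = UA_relations(4-6,13-15,20,23,26,29,32)

text \<open>The coefficient part of \<open>d\<^sub>0 d\<^sub>1 = d\<^sub>0 d\<^sub>0\<close>; the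
  module is a right one, so the left factor acts first. Only lower bounds of \<open>r\<close>
  matter, so \<open>r\<close> plays the part of a third label.\<close>

lemma alpha_contract:
  "UA_gen (first_cmp (p # q # r)) a \<otimes>\<^bsub>UA\<^esub> UA_gen (first_cmp (q # r)) b
    = (case labelled_mult (p, a) (q, b) of (s, c) \<Rightarrow> UA_gen (first_cmp (s # r)) c)"
proof -
  consider "p < q" | "q < p" | "p = q" by linarith
  then show ?thesis
  proof cases
    case 1
    then show ?thesis by (auto simp: labelled_mult_def first_cmp_def alpha_alpha)
  next
    case 2
    then show ?thesis by (auto simp: labelled_mult_def first_cmp_def alpha_alpha)
  next
    case 3
    then show ?thesis by (auto simp: labelled_mult_def first_cmp_def alpha_alpha)
  qed
qed

text \<open>The coefficient part of the identity for the two last faces. The last letter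
  \<open>b\<close> acts first, whence the reversed order of the factors.\<close>

lemma beta_contract:
  "UA_gen (last_cmp (r @ [p, q])) b \<otimes>\<^bsub>UA\<^esub> UA_gen (last_cmp (r @ [p])) a
    = (case labelled_mult (p, a) (q, b) of (s, c) \<Rightarrow> UA_gen (last_cmp (r @ [s])) c)"
proof -
  consider "p < q" | "q < p" | "p = q" by linarith
  then show ?thesis
  proof cases
    case 1
    then show ?thesis by (auto simp: labelled_mult_def last_cmp_def beta_beta butlast_append)
  next
    case 2
    then show ?thesis by (auto simp: labelled_mult_def last_cmp_def beta_beta butlast_append)
  next
    case 3
    then show ?thesis by (auto simp: labelled_mult_def last_cmp_def beta_beta butlast_append)
  qed
qed

text \<open>Removing the letter at one end first may change the copy used at the other end, because
  one label has gone from the comparison. For \<open>r = []\<close> and \<open>p = q\<close>, for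
  instance, this is relation (26).\<close>

lemma beta_alpha_commute:
  "UA_gen (last_cmp (p # r @ [q])) b \<otimes>\<^bsub>UA\<^esub> UA_gen (first_cmp (p # r)) a
    = UA_gen (first_cmp (p # r @ [q])) a \<otimes>\<^bsub>UA\<^esub> UA_gen (last_cmp (r @ [q])) b"
proof -
  consider "p < q" | "q < p" | "p = q" by linarith
  then show ?thesis
  proof cases
    case 1
    then show ?thesis by (auto simp: first_cmp_def last_cmp_def beta_alpha butlast_append)
  next
    case 2
    then show ?thesis by (auto simp: first_cmp_def last_cmp_def beta_alpha butlast_append)
  next
    case 3
    then show ?thesis by (auto simp: first_cmp_def last_cmp_def beta_alpha butlast_append)
  qed
qed

end

section \<open>Faces and the differential\<close>

text \<open>Follows one varied letter through a contraction: it is dropped, kept in place,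
  multiplied from the right or from the left, or shifted. These are the cases for multilinearity of
  a face.\<close>

lemma update_contract:
  assumes "k < length a" "i \<le> length a"
  shows "contract f i (a[k := v]) =
    (if k = 0 \<and> i = 0 \<or> Suc k = length a \<and> i = length a then contract f i a
     else if Suc k < i then (contract f i a)[k := v]
     else if Suc k = i then (contract f i a)[k := f v (a ! i)]
     else if k = i then (contract f i a)[i - 1 := f (a ! (i - 1)) v]
     else (contract f i a)[k - 1 := v])"
  using assms by (intro nth_equalityI) (auto simp: nth_contract nth_list_update)

text \<open>Here \<open>t j i\<close> stands for face \<open>j\<close> followed by face
  \<open>i\<close>. The pair \<open>(j, i)\<close> with \<open>i < j\<close> is matched with
  \<open>(i, j - 1)\<close>: same element, opposite sign.\<close>

lemma alternating_face_sum:
  fixes t :: "nat \<Rightarrow> nat \<Rightarrow> 'b"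
  assumes "\<And>i j. i < j \<Longrightarrow> j \<le> Suc n \<Longrightarrow> t j i = t i (j - 1)"
  shows "(\<Sum>j\<le>Suc n. \<Sum>i\<le>n. Poly_Mapping.single (t j i) ((- 1 :: 'k::comm_ring_1) ^ (j + i))) = 0"
proof -
  let ?f = "\<lambda>(j, i). Poly_Mapping.single (t j i) ((- 1 :: 'k) ^ (j + i))"
  let ?A = "{(j, i). i < j \<and> j \<le> Suc n}" and ?B = "{(j, i). j \<le> i \<and> i \<le> n}"
  have fin: "finite ?A" "finite ?B"
    by (rule finite_subset[of _ "{..Suc n} \<times> {..Suc n}"]; auto)+
  have "(\<Sum>j\<le>Suc n. \<Sum>i\<le>n. ?f (j, i)) = sum ?f ({..Suc n} \<times> {..n})"
    by (simp only: sum.cartesian_product split_def prod.collapse)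
  also have "{..Suc n} \<times> {..n} = ?A \<union> ?B" by auto
  also have "sum ?f (?A \<union> ?B) = sum ?f ?A + sum ?f ?B"
    by (rule sum.union_disjoint) (use fin in auto)
  also have "sum ?f ?A = (\<Sum>p\<in>?B. - ?f p)"
  proof (rule sum.reindex_bij_witness[of _ "\<lambda>(i, j). (Suc j, i)" "\<lambda>(j, i). (i, j - 1)"])
    fix p assume "p \<in> ?A"
    then obtain j i where p: "p = (Suc j, i)" "i \<le> j" "j \<le> n" by (cases p; cases "fst p") auto
    then show "- ?f (case p of (j, i) \<Rightarrow> (i, j - 1)) = ?f p"
      using assms[of i "Suc j"] by (simp add: single_uminus add.commute)
  qed auto
  also have "\<dots> + sum ?f ?B = 0" by (simp add: sum_negf)
  finally show ?thesis by simp
qed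

lemma type_module_simps [simp]:
  "carrier (type_module s) = UNIV" "x \<oplus>\<^bsub>type_module s\<^esub> y = x + y" "c \<odot>\<^bsub>type_module s\<^esub> x = s c x"
  "\<zero>\<^bsub>type_module s\<^esub> = 0"
  by (simp_all add: type_module_def)

lemma module_type_module:
  assumes "\<And>a b x. s (a + b) x = s a x + s b x" "\<And>a x y. s a (x + y) = s a x + s a y"
    "\<And>a b x. s (a * b) x = s a (s b x)" "\<And>x. s 1 x = x"
  shows "module type_ring (type_module s)"
proof (rule moduleI[OF cring_type_ring])
  show "abelian_group (type_module s)"
  proof (rule abelian_groupI)
    fix x show "\<exists>y\<in>carrier (type_module s). y \<oplus>\<^bsub>type_module s\<^esub> x = \<zero>\<^bsub>type_module s\<^esub>"
      by (intro bexI[of _ "- x"]) auto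
  qed (auto simp: algebra_simps)
qed (auto simp: assms)

lemma tuples_type_module: "tuples (type_module s) n = {a. length a = n}"
  by (auto simp: tuples_def)

lemma linear_map_restrict:
  assumes "module (type_ring :: 'k::field ring) V" "linear_map V W f"
  shows "linear_map V W (restrict f (carrier V))"
proof -
  interpret V: module type_ring V by fact
  show ?thesis
    unfolding linear_map_def using linear_mapD[OF assms(2)] V.smult_closed[simplified] by simp
qed

lemma linear_map_sum_free_module:
  fixes W :: "('k::field, 'w) module"
  assumes W: "module type_ring W" and f: "linear_map (free_module S) W f"
    and "finite I" "\<And>i. i \<in> I \<Longrightarrow> Poly_Mapping.keys (p i) \<subseteq> S"
  shows "f (\<Sum>i\<in>I. p i) = (\<Oplus>\<^bsub>W\<^esub>i\<in>I. f (p i))"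
  using assms(3,4)
proof (induction I rule: finite_induct)
  case empty
  interpret W: module type_ring W by (rule W)
  show ?case using linear_map_zero[OF module_free_module W f] by simp
next
  case (insert i I)
  interpret W: module type_ring W by (rule W)
  have "Poly_Mapping.keys (\<Sum>i\<in>I. p i) \<subseteq> (\<Union>i\<in>I. Poly_Mapping.keys (p i))" by (rule keys_sum)
  then have "Poly_Mapping.keys (\<Sum>i\<in>I. p i) \<subseteq> S" using insert.prems by blast
  then show ?case using insert linear_mapD(1,2)[OF f] by (simp add: Pi_iff)
qed

context triassociative_algebra
begin

lemma map_fst_contract:
  "k \<le> length w \<Longrightarrow> map fst (contract labelled_mult k w) = contract min k (map fst w)"
  by (rule map_contract) (simp_all add: fst_labelled_mult)

abbreviation A_space where "A_space \<equiv> type_module scale"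

lemma module_A_space: "module type_ring A_space"
  by (rule module_type_module) (simp_all add: scale_left_distrib scale_right_distrib)

lemma linear_leaf_prod:
  "linear_map A_space A_space (\<lambda>v. v \<stileturn> b)" "linear_map A_space A_space (\<lambda>v. b \<stileturn> v)"
  "linear_map A_space A_space (\<lambda>v. v \<turnstile> b)" "linear_map A_space A_space (\<lambda>v. b \<turnstile> v)"
  "linear_map A_space A_space (\<lambda>v. v \<bottom> b)" "linear_map A_space A_space (\<lambda>v. b \<bottom> v)"
  using lprod_linear_left[of b] lprod_linear_right[of b] rprod_linear_left[of b]
    rprod_linear_right[of b] mprod_linear_left[of b] mprod_linear_right[of b]
  by (simp_all add: linear_map_def Vector_Spaces.linear_iff)

end

section \<open>Existence and uniqueness of the face maps\<close>

context trias_corepresentation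
begin

lemma module_N_space: "module type_ring N_space"
  unfolding N_space_def
proof (rule module_type_module)
  fix a b :: 'k and x y :: 'n
  show "act x (UA_const (a + b)) = act x (UA_const a) + act x (UA_const b)"
    by (simp add: UA_const_add act_add_right UA_const_closed)
  show "act (x + y) (UA_const a) = act x (UA_const a) + act y (UA_const a)"
    by (simp add: act_add_left UA_const_closed)
  have "act x (UA_const (b * a)) = act (act x (UA_const b)) (UA_const a)"
    by (simp add: UA_const_mult act_mult UA_const_closed)
  then show "act x (UA_const (a * b)) = act (act x (UA_const b)) (UA_const a)"
    by (simp add: mult.commute)
  show "act x (UA_const 1) = x" by (simp add: UA_const_one act_one)
qed

lemma act_gen_gen: "act (act x (UA_gen s a)) (UA_gen t b) = act x (UA_gen s a \<otimes>\<^bsub>UA\<^esub> UA_gen t b)"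
  by (simp add: act_mult UA_gen_closed)

text \<open>Scalars act on \<open>N\<close> through constants of the enveloping algebra, so
  compatibility with scalars rests on constants commuting with generators.\<close>

lemma linear_act_gen:
  "linear_map N_space N_space (\<lambda>x. act x (UA_gen s a))"
  "linear_map A_space N_space (\<lambda>a. act x (UA_gen s a))"
  by (simp_all add: linear_map_def N_space_def act_add_left act_add_right UA_gen_add UA_gen_scale UA_gen_closed
      UA_const_closed UA_const_central flip: act_mult)

lemma linear_leaf_prod':
  "linear_map A_space A_space (\<lambda>v. leaf_prod \<psi> i v b)" "linear_map A_space A_space (\<lambda>v. leaf_prod \<psi> i b v)"
  by (cases "orient i \<psi>"; simp add: leaf_prod_def linear_leaf_prod)+

text \<open>The two copies are parameters, so that those read off the tree can be exchanged for
  those read off a labelling.\<close>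

definition face_act :: "copy \<Rightarrow> copy \<Rightarrow> nat \<Rightarrow> 'n \<Rightarrow> 'a list \<Rightarrow> 'n" where
  "face_act s t i x a =
     (if i = 0 then act x (UA_gen s (hd a)) else if i < length a then x else act x (UA_gen t (last a)))"

lemma tree_face_eq:
  "tree_face \<psi> i (x, a) =
     (face_act (first_copy \<psi>) (last_copy \<psi>) i x a, contract (leaf_prod \<psi> i) i a)"
  by (simp add: tree_face_def face_act_def contract_def)

lemma linear_face_act: "linear_map N_space N_space (\<lambda>x. face_act s t i x a)"
proof -
  have "linear_map N_space N_space (\<lambda>x. x)" by (simp add: linear_map_def)
  then show ?thesis by (cases "i = 0"; cases "i < length a") (simp_all add: face_act_def linear_act_gen)
qed

lemma chains_eq: "chains n = tree_tensor (trees n) N_space A_space n"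
  and chain_eq: "chain n \<psi> (x, a) = tree_gen (trees n) N_space A_space n \<psi> x a"
  by (simp_all add: chains_def A_power_def tree_tensor_def chain_def tree_gen_def)

lemma module_chains: "module type_ring (chains n)"
  unfolding chains_eq by (rule module_tree_tensor[OF module_N_space module_A_space])

lemma generates_chains:
  "generates (chains n) ((\<lambda>(\<psi>, x, a). chain n \<psi> (x, a)) ` (trees n \<times> UNIV \<times> {a. length a = n}))"
  using generates_tree_tensor[OF module_N_space module_A_space, of "trees n" n]
  by (simp add: chains_eq chain_eq tuples_type_module N_space_def)

lemma delete_leaf_lab:
  assumes "lab \<psi> d" "i \<le> length d" "d \<noteq> []"
  shows "delete_leaf i \<psi> \<in> trees (length d - 1)"
  using lab_proper(1)[OF lab_delete(1)[OF assms]] by (simp add: trees_def)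

lemma trees_lab: "\<psi> \<in> trees n \<Longrightarrow> \<exists>d. lab \<psi> d \<and> length d = n"
  using ex_lab lab_proper(1) by (fastforce simp: trees_def)

lemma delete_leaf_trees:
  assumes "\<psi> \<in> trees n" "1 \<le> n" "i \<le> n"
  shows "delete_leaf i \<psi> \<in> trees (n - 1)"
proof -
  obtain d where "lab \<psi> d" "length d = n" using trees_lab[OF assms(1)] by blast
  then show ?thesis using delete_leaf_lab[of \<psi> d i] assms by (cases d) auto
qed

lemma ex_face:
  assumes n: "1 \<le> n" "i \<le> n"
  shows "\<exists>f. linear_map (chains n) (chains (n - 1)) f \<and>
    (\<forall>\<psi>\<in>trees n. \<forall>x a. length a = n \<longrightarrow>
        f (chain n \<psi> (x, a)) = chain (n - 1) (delete_leaf i \<psi>) (tree_face \<psi> i (x, a)))"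
proof -
  note NA = module_N_space module_A_space
  let ?g = "\<lambda>\<psi>. tree_gen (trees (n - 1)) N_space A_space (n - 1) (delete_leaf i \<psi>)"
  let ?F = "\<lambda>\<psi> x a. ?g \<psi> (face_act (first_copy \<psi>) (last_copy \<psi>) i x a) (contract (leaf_prod \<psi> i) i a)"
  have len: "length (contract f i a) = n - 1" if "length a = n" for f and a :: "'a list"
    using that by simp
  have "\<exists>f. linear_map (chains n) (chains (n - 1)) f \<and>
    (\<forall>\<psi>\<in>trees n. \<forall>x\<in>carrier N_space. \<forall>a\<in>tuples A_space n.
       f (tree_gen (trees n) N_space A_space n \<psi> x a) = ?F \<psi> x a)"
    unfolding chains_eq[of n]
  proof (rule tree_tensor_lift[OF NA module_chains])
    fix \<psi> assume \<psi>: "\<psi> \<in> trees n"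
    have \<psi>': "delete_leaf i \<psi> \<in> trees (n - 1)" using delete_leaf_trees \<psi> n by blast
    have lin: "linear_map N_space (chains (n - 1)) (\<lambda>x. ?g \<psi> x a)" if "length a = n - 1" for a
      unfolding chains_eq by (rule linear_tree_gen[OF NA \<psi>']) (simp add: that tuples_type_module)
    have "multilinear_map A_space (n - 1) (chains (n - 1)) (?g \<psi> x)" for x
      unfolding chains_eq by (rule multilinear_tree_gen[OF NA \<psi>']) (simp add: N_space_def)
    then have ml: "linear_map A_space (chains (n - 1)) (\<lambda>v. ?g \<psi> x (a[k := v]))"
      if "length a = n - 1" "k < n - 1" for x a k
      using that by (simp add: multilinear_map_def tuples_type_module)
    show "linear_map N_space (chains (n - 1)) (\<lambda>x. ?F \<psi> x a)" if "a \<in> tuples A_space n" for a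
      using linear_map_comp[OF linear_face_act lin[OF len]] that by (simp add: tuples_type_module)
    fix x
    show "multilinear_map A_space n (chains (n - 1)) (?F \<psi> x)"
      unfolding multilinear_map_def tuples_type_module
    proof (intro conjI ballI allI impI)
      show "?F \<psi> x \<in> {a. length a = n} \<rightarrow> carrier (chains (n - 1))"
        using linear_mapD(1)[OF lin[OF len]] by (auto simp: N_space_def)
      fix a :: "'a list" and k assume "a \<in> {a. length a = n}" and k: "k < n"
      then have a: "length a = n" by simp
      let ?s = "first_copy \<psi>" and ?t = "last_copy \<psi>"
      note upd = update_contract[of k a i "leaf_prod \<psi> i", unfolded a, OF k n(2)]
      show "linear_map A_space (chains (n - 1)) (\<lambda>v. ?F \<psi> x (a[k := v]))"
      proof (cases "k = 0 \<and> i = 0 \<or> Suc k = n \<and> i = n")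
        case True
        \<comment> \<open>The varied letter is the one that acts on \<open>N\<close>; the remaining
          word does not contain it.\<close>
        have "linear_map A_space N_space (\<lambda>v. face_act ?s ?t i x (a[k := v]))"
        proof (cases "i = 0")
          case True
          moreover have "k = 0" using \<open>k = 0 \<and> i = 0 \<or> Suc k = n \<and> i = n\<close> True n by simp
          ultimately show ?thesis using linear_act_gen(2) a n by (cases a) (simp_all add: face_act_def)
        next
          case False
          then have "Suc k = n" "i = n" using True by auto
          moreover from this have "last (a[k := v]) = v" for v
            using a by (metis diff_Suc_1 last_list_update list.size(3) nat.distinct(1))
          ultimately show ?thesis using linear_act_gen(2) a n by (simp add: face_act_def)
        qed
        from linear_map_comp[OF this lin[OF len[OF a]]] show ?thesis using True upd by simp
      next
        case False
        \<comment> \<open>Now the acting letter, if there is one, is not the varied one, so only the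
          word depends on \<open>v\<close>.\<close>
        then have fa: "face_act ?s ?t i x (a[k := v]) = face_act ?s ?t i x a" for v
          using a k n by (cases a; cases k) (auto simp: face_act_def last_list_update)
        note m = ml[OF len[OF a], of _ "face_act ?s ?t i x a" "leaf_prod \<psi> i"]
        consider "Suc k < i" | "Suc k = i" | "k = i" | "i < k" by linarith
        then show ?thesis
        proof cases
          case 1
          then show ?thesis using upd fa m[of k] False n by simp
        next
          case 2
          then show ?thesis using upd fa linear_map_comp[OF linear_leaf_prod'(1) m[of k]] False n by simp
        next
          case 3
          then show ?thesis using upd fa linear_map_comp[OF linear_leaf_prod'(2) m[of "i - 1"]] False n k by simp
        next
          case 4
          then show ?thesis using upd fa m[of "k - 1"] False n k by simp
        qed
      qed
    qed
  qed
  then show ?thesis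
    by (auto simp: chain_eq tree_face_eq tuples_type_module N_space_def)
qed

text \<open>The definite description is justified by \<open>ex_face\<close> for existence and, for
  uniqueness, by generators inside the carrier and extensionality outside it.\<close>

lemma face:
  assumes "1 \<le> n" "i \<le> n"
  shows linear_face: "linear_map (chains n) (chains (n - 1)) (face n i)"
    and face_chain: "\<psi> \<in> trees n \<Longrightarrow> length a = n \<Longrightarrow>
      face n i (chain n \<psi> (x, a)) = chain (n - 1) (delete_leaf i \<psi>) (tree_face \<psi> i (x, a))"
proof -
  let ?P = "\<lambda>f. linear_map (chains n) (chains (n - 1)) f \<and> f \<in> extensional (carrier (chains n)) \<and>
     (\<forall>\<psi>\<in>trees n. \<forall>x a. length a = n \<longrightarrow>
        f (chain n \<psi> (x, a)) = chain (n - 1) (delete_leaf i \<psi>) (tree_face \<psi> i (x, a)))"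
  obtain f where f: "linear_map (chains n) (chains (n - 1)) f"
    "\<And>\<psi> x a. \<psi> \<in> trees n \<Longrightarrow> length a = n \<Longrightarrow>
      f (chain n \<psi> (x, a)) = chain (n - 1) (delete_leaf i \<psi>) (tree_face \<psi> i (x, a))"
    using ex_face[OF assms] by blast
  have mem: "chain n \<psi> (x, a) \<in> carrier (chains n)" if "\<psi> \<in> trees n" "length a = n" for \<psi> x a
    using generates_mem[OF generates_chains, of "chain n \<psi> (x, a)" n] that by force
  have ex: "?P (restrict f (carrier (chains n)))"
  proof (intro conjI ballI allI impI)
    fix \<psi> x and a :: "'a list" assume "\<psi> \<in> trees n" "length a = n"
    then show "restrict f (carrier (chains n)) (chain n \<psi> (x, a))
        = chain (n - 1) (delete_leaf i \<psi>) (tree_face \<psi> i (x, a))"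
      using f(2) mem by (simp only: restrict_apply' simp_thms)
  qed (rule linear_map_restrict[OF module_chains f(1)] restrict_extensional)+
  have uniq: "g = h" if g: "?P g" and h: "?P h" for g h
  proof (rule extensionalityI)
    show "g \<in> extensional (carrier (chains n))" "h \<in> extensional (carrier (chains n))"
      by (rule g[THEN conjunct2, THEN conjunct1] h[THEN conjunct2, THEN conjunct1])+
    fix X assume X: "X \<in> carrier (chains n)"
    show "g X = h X"
    proof (rule linear_map_eqI[OF module_chains module_chains _ _ generates_chains _ X])
      show "linear_map (chains n) (chains (n - 1)) g" "linear_map (chains n) (chains (n - 1)) h"
        by (rule g[THEN conjunct1] h[THEN conjunct1])+
      fix Y assume "Y \<in> (\<lambda>(\<psi>, x, a). chain n \<psi> (x, a)) ` (trees n \<times> UNIV \<times> {a. length a = n})"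
      then obtain \<psi> x a where Y: "Y = chain n \<psi> (x, a)" "\<psi> \<in> trees n" "length a = n" by auto
      show "g Y = h Y"
        using g[THEN conjunct2, THEN conjunct2, rule_format, OF Y(2,3)]
          h[THEN conjunct2, THEN conjunct2, rule_format, OF Y(2,3)] by (simp only: Y(1))
    qed
  qed
  have "\<exists>!f. ?P f" by (rule ex1I[of ?P, OF ex]) (rule uniq[OF _ ex])
  then have P: "?P (face n i)" unfolding face_def by (rule theI'[of ?P])
  show "linear_map (chains n) (chains (n - 1)) (face n i)" by (rule conjunct1[OF P])
  assume "\<psi> \<in> trees n" "length a = n"
  with P[THEN conjunct2, THEN conjunct2]
  show "face n i (chain n \<psi> (x, a)) = chain (n - 1) (delete_leaf i \<psi>) (tree_face \<psi> i (x, a))"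
    by blast
qed

lemma linear_differential:
  assumes "1 \<le> n"
  shows "linear_map (chains n) (chains (n - 1)) (differential n)"
  unfolding differential_def[abs_def]
proof (rule linear_map_finsum_fun[OF module_chains,
      where f = "\<lambda>i X. (- 1) ^ i \<odot>\<^bsub>chains (n - 1)\<^esub> face n i X"])
  fix i assume "i \<in> {0..n}"
  then have "i \<le> n" by simp
  then show "linear_map (chains n) (chains (n - 1)) (\<lambda>X. (- 1) ^ i \<odot>\<^bsub>chains (n - 1)\<^esub> face n i X)"
    by (rule linear_map_smult[OF module_chains linear_face[OF assms]])
qed simp

text \<open>The coefficient part of all simplicial identities at once, with the tree replaced by its
  heights.\<close>

lemma face_act_labelled:
  assumes w: "i < j" "j \<le> length w" "2 \<le> length w"
  defines "X \<equiv> \<lambda>i x w. face_act (first_cmp (map fst w)) (last_cmp (map fst w)) i x (map snd w)"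
    and "C \<equiv> contract labelled_mult"
  shows "X i (X j x w) (C j w) = X (j - 1) (X i x w) (C i w)"
proof -
  have fst_C: "map fst (C k w) = contract min k (map fst w)" if "k \<le> length w" for k
    unfolding C_def using that by (rule map_fst_contract)
  \<comment> \<open>In cases 1, 3 and 6 the three groups of relations enter. In cases 2 and 5 the
    inner face leaves the acting letter and its comparison with the others unchanged; in case 4
    nothing acts.\<close>
  consider "i = 0" "j = 1" | "i = 0" "1 < j" "j < length w" | "i = 0" "j = length w"
    | "0 < i" "j < length w" | "0 < i" "j = length w" "Suc i < length w" | "0 < i" "j = length w" "Suc i = length w"
    using w by linarith
  then show ?thesis
  proof cases
    case 1
    then obtain u v r where "w = u # v # r" using w by (cases w; cases "tl w") auto
    then show ?thesis using 1 alpha_contract[of "fst u" "fst v" "map fst r" "snd u" "snd v"]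
      by (auto simp: X_def C_def face_act_def contract_def act_gen_gen split: prod.splits)
  next
    case 2
    then have "hd (C j w) = hd w" "length (C j w) = length w - 1" "w \<noteq> []" "C j w \<noteq> []" 
      unfolding C_def using w by (auto simp: hd_conv_nth nth_contract simp flip: length_greater_0_conv)
    moreover have "j - Suc 0 < length w - Suc 0" using 2 by simp
    ultimately show ?thesis
      using 2 w by (simp add: X_def face_act_def fst_C first_cmp_contract hd_map) (simp add: C_def)
  next
    case 3
    then obtain u v r where "w = u # r @ [v]"
      using w by (cases w; cases "tl w" rule: rev_cases) auto
    then show ?thesis using 3 beta_alpha_commute[of "fst u" "map fst r" "fst v" "snd v" "snd u"]
      by (simp add: X_def C_def face_act_def contract_def act_gen_gen butlast_append)
  next
    case 4
    moreover from this have "j - Suc 0 < length w - Suc 0" "i < length w - Suc 0" using w by simp_all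
    ultimately show ?thesis using w by (simp add: X_def C_def face_act_def)
  next
    case 5
    have "Suc (length w - Suc (Suc 0)) = length w - Suc 0" using w by simp
    with 5 have "last (C i w) = last w" "w \<noteq> []" "C i w \<noteq> []"
      unfolding C_def using w by (auto simp: last_conv_nth nth_contract simp flip: length_greater_0_conv)
    moreover have "i < length w - Suc 0" using 5 by simp
    ultimately show ?thesis
      using 5 w by (simp add: X_def face_act_def fst_C last_cmp_contract last_map) (simp add: C_def)
  next
    case 6
    then obtain u v r where "w = r @ [u, v]"
      using w by (cases w rule: rev_cases; cases "butlast w" rule: rev_cases) auto
    then show ?thesis using 6 beta_contract[of "map fst r" "fst u" "fst v" "snd v" "snd u"]
      by (auto simp: X_def C_def face_act_def contract_def act_gen_gen butlast_append nth_append split: prod.splits)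
  qed
qed

text \<open>Orientation of inner leaves and the copies at both ends are functions of the labels, so
  from here on a face is computed from the word alone.\<close>

lemma tree_face_lab:
  assumes "lab \<psi> (map fst w)" "i \<le> length w" "w \<noteq> []"
  shows "tree_face \<psi> i (x, map snd w) =
    (face_act (first_cmp (map fst w)) (last_cmp (map fst w)) i x (map snd w), map snd (contract labelled_mult i w))"
proof -
  have "leaf_prod \<psi> i (snd (w ! (i - 1))) (snd (w ! i)) = snd (labelled_mult (w ! (i - 1)) (w ! i))"
    if "0 < i" "i < length w"
    using that orient_lab[OF assms(1), of i]
    by (auto simp: leaf_prod_def cmp_def labelled_mult_def split: prod.split)
  then have "contract (leaf_prod \<psi> i) i (map snd w) = map snd (contract labelled_mult i w)"
    using assms by (simp add: contract_def map_tl map_butlast take_map drop_map)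
  then show ?thesis
    using assms first_copy_lab[OF assms(1)] last_copy_lab[OF assms(1)] by (simp add: tree_face_eq)
qed

section \<open>Simplicial identities on generators\<close>

definition gen_face :: "nat \<Rightarrow> ptree \<times> 'n \<times> 'a list \<Rightarrow> ptree \<times> 'n \<times> 'a list" where
  "gen_face i = (\<lambda>(\<psi>, x, a). (delete_leaf i \<psi>, tree_face \<psi> i (x, a)))"

definition gens :: "nat \<Rightarrow> (ptree \<times> 'n \<times> 'a list) set" where
  "gens n = trees n \<times> UNIV \<times> {a. length a = n}"

lemma gen_face_gens: "s \<in> gens n \<Longrightarrow> 1 \<le> n \<Longrightarrow> i \<le> n \<Longrightarrow> gen_face i s \<in> gens (n - 1)"
  using delete_leaf_trees[of _ n i] by (auto simp: gens_def gen_face_def tree_face_eq)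

text \<open>Any labelling \<open>d\<close> of the tree is zipped with the letters. The word of pairs
  then settles all three components: the trees through \<open>lab_unique\<close>, the letters
  through \<open>contract_contract\<close>, the coefficients through
  \<open>face_act_labelled\<close>.\<close>

lemma gen_face_gen_face:
  assumes s: "s \<in> gens n" and n: "2 \<le> n" and ij: "i < j" "j \<le> n"
  shows "gen_face i (gen_face j s) = gen_face (j - 1) (gen_face i s)"
proof -
  obtain \<psi> x a where s': "s = (\<psi>, x, a)" "\<psi> \<in> trees n" "length a = n" using s by (auto simp: gens_def)
  obtain d where d: "lab \<psi> d" "length d = n" using trees_lab[OF s'(2)] by blast
  define w where "w = zip d a"
  have w: "map fst w = d" "map snd w = a" "length w = n" using d s' by (simp_all add: w_def)
  have lab: "lab (delete_leaf k \<psi>') (map fst (contract labelled_mult k w'))"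
    if "lab \<psi>' (map fst w')" "k \<le> length w'" "w' \<noteq> []" for \<psi>' k w'
    using lab_delete(1)[OF that(1), of k] that map_fst_contract[OF that(2)] by simp
  have step: "gen_face k (\<psi>', y, map snd w') = (delete_leaf k \<psi>',
      face_act (first_cmp (map fst w')) (last_cmp (map fst w')) k y (map snd w'), map snd (contract labelled_mult k w'))"
    if "lab \<psi>' (map fst w')" "k \<le> length w'" "w' \<noteq> []" for \<psi>' k w' y
    using tree_face_lab[OF that] by (simp add: gen_face_def)
  have ne: "w \<noteq> []" "contract labelled_mult k w \<noteq> []" for k
    using w n by (auto simp flip: length_greater_0_conv)
  have l0: "lab \<psi> (map fst w)" using d w by simp
  have l: "lab (delete_leaf k \<psi>) (map fst (contract labelled_mult k w))" if "k \<le> n" for k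
    using lab[OF l0 _ ne(1)] that w by simp
  note cc = contract_contract[where f = labelled_mult, OF labelled_mult_assoc ij(1), of w]
  have s'': "s = (\<psi>, x, map snd w)" using s' w by simp
  have "lab (delete_leaf i (delete_leaf j \<psi>)) (map fst (contract labelled_mult i (contract labelled_mult j w)))"
    by (rule lab[OF l]) (use ij w ne in auto)
  moreover have "lab (delete_leaf (j - 1) (delete_leaf i \<psi>)) (map fst (contract labelled_mult (j - 1) (contract labelled_mult i w)))"
    by (rule lab[OF l]) (use ij w ne in auto)
  ultimately have "delete_leaf i (delete_leaf j \<psi>) = delete_leaf (j - 1) (delete_leaf i \<psi>)"
    using cc ij n w lab_unique(1) by metis
  moreover have "gen_face k (gen_face l s) = (delete_leaf k (delete_leaf l \<psi>),
      face_act (first_cmp (map fst (contract labelled_mult l w))) (last_cmp (map fst (contract labelled_mult l w))) k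
        (face_act (first_cmp (map fst w)) (last_cmp (map fst w)) l x (map snd w)) (map snd (contract labelled_mult l w)),
      map snd (contract labelled_mult k (contract labelled_mult l w)))"
    if kl: "l \<le> n" "k \<le> n - 1" for k l
  proof -
    have "l \<le> length w" "k \<le> length (contract labelled_mult l w)" using kl w by simp_all
    then show ?thesis unfolding s'' by (simp only: step[OF l0 _ ne(1)] step[OF l[OF kl(1)] _ ne(2)])
  qed
  moreover have "j - 1 \<le> n - 1" "i \<le> n" "i \<le> n - 1" using ij by auto
  ultimately show ?thesis
    using face_act_labelled[OF ij(1), of w x] cc ij n w(3) by simp
qed

section \<open>The square of the differential\<close>

definition gen_chain :: "nat \<Rightarrow> ptree \<times> 'n \<times> 'a list \<Rightarrow> _" where
  "gen_chain n = (\<lambda>(\<psi>, x, a). chain n \<psi> (x, a))"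

lemma gen_chain_closed: "gen_chain n \<in> gens n \<rightarrow> carrier (chains n)"
  using generates_chains[of n] by (force simp: generates_def gens_def gen_chain_def)

text \<open>Writes the sum in the chain module as the image of a formal sum of triples, so that
  cancellation can be carried out formally.\<close>

lemma differential_gen_chain:
  assumes "s \<in> gens n" "1 \<le> n"
  shows "differential n (gen_chain n s) =
    lin_ext (chains (n - 1)) (gen_chain (n - 1)) (\<Sum>i\<le>n. Poly_Mapping.single (gen_face i s) ((- 1) ^ i))"
proof -
  interpret C: module type_ring "chains (n - 1)" by (rule module_chains)
  have f: "face n i (gen_chain n s) = gen_chain (n - 1) (gen_face i s)" if "i \<le> n" for i
    using face_chain[OF assms(2) that] assms(1)
    by (auto simp: gen_chain_def gen_face_def gens_def split: prod.split)
  have c: "gen_chain (n - 1) (gen_face i s) \<in> carrier (chains (n - 1))" if "i \<le> n" for i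
    using gen_chain_closed gen_face_gens[OF assms that] by blast
  have "lin_ext (chains (n - 1)) (gen_chain (n - 1)) (\<Sum>i\<le>n. Poly_Mapping.single (gen_face i s) ((- 1) ^ i))
      = (\<Oplus>\<^bsub>chains (n - 1)\<^esub>i\<in>{..n}. lin_ext (chains (n - 1)) (gen_chain (n - 1)) (Poly_Mapping.single (gen_face i s) ((- 1) ^ i)))"
    by (rule linear_map_sum_free_module[OF module_chains linear_lin_ext[OF module_chains gen_chain_closed]])
      (use gen_face_gens[OF assms] in auto)
  also have "\<dots> = differential n (gen_chain n s)"
    unfolding differential_def
    by (rule C.M.finsum_cong')
      (simp_all add: atMost_atLeast0 Pi_iff lin_ext_single[where g = "gen_chain (n - 1)", OF module_chains] f c
        del: One_nat_def)
  finally show ?thesis by simp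
qed

lemma differential_differential_gen_chain:
  assumes s: "s \<in> gens n" and n: "2 \<le> n"
  shows "differential (n - 1) (differential n (gen_chain n s)) = \<zero>\<^bsub>chains (n - 2)\<^esub>"
proof -
  have n': "1 \<le> n" "1 \<le> n - 1" "n - 1 - 1 = n - 2" using n by auto
  let ?C1 = "chains (n - 1)" and ?C2 = "chains (n - 2)"
  interpret C1: module type_ring ?C1 by (rule module_chains)
  interpret C2: module type_ring ?C2 by (rule module_chains)
  let ?L = "lin_ext ?C2 (gen_chain (n - 2))"
  have L: "linear_map (free_module (gens (n - 2))) ?C2 ?L"
    by (rule linear_lin_ext[OF module_chains gen_chain_closed])
  have D: "linear_map ?C1 ?C2 (differential (n - 1))"
    using linear_differential[OF n'(2)] n'(3) by simp
  let ?P = "\<lambda>j. \<Sum>i\<le>n - 1. Poly_Mapping.single (gen_face i (gen_face j s)) ((- 1 :: 'k) ^ (j + i))"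
  have g1: "gen_face j s \<in> gens (n - 1)" if "j \<le> n" for j
    using gen_face_gens[OF s n'(1) that] .
  have g2: "gen_face i (gen_face j s) \<in> gens (n - 2)" if "j \<le> n" "i \<le> n - 1" for i j
    using gen_face_gens[OF g1[OF that(1)] n'(2) that(2)] n'(3) by simp
  have keys: "Poly_Mapping.keys (\<Sum>i\<le>n - 1. Poly_Mapping.single (gen_face i (gen_face j s)) (c i :: 'k)) \<subseteq> gens (n - 2)"
    if "j \<le> n" for j c
  proof -
    have "Poly_Mapping.keys (\<Sum>i\<le>n - 1. Poly_Mapping.single (gen_face i (gen_face j s)) (c i))
      \<subseteq> (\<Union>i\<le>n - 1. Poly_Mapping.keys (Poly_Mapping.single (gen_face i (gen_face j s)) (c i)))"
      by (rule keys_sum)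
    then show ?thesis using g2[OF that] by (auto split: if_splits)
  qed
  have step: "differential (n - 1) ((- 1) ^ j \<odot>\<^bsub>?C1\<^esub> face n j (gen_chain n s)) = ?L (?P j)" if j: "j \<le> n" for j
  proof -
    have f: "face n j (gen_chain n s) = gen_chain (n - 1) (gen_face j s)"
      using face_chain[OF n'(1) j] s by (auto simp: gen_chain_def gen_face_def gens_def split: prod.split)
    have "gen_chain (n - 1) (gen_face j s) \<in> carrier ?C1" using gen_chain_closed g1[OF j] by blast
    then have "differential (n - 1) ((- 1) ^ j \<odot>\<^bsub>?C1\<^esub> face n j (gen_chain n s))
        = (- 1) ^ j \<odot>\<^bsub>?C2\<^esub> differential (n - 1) (gen_chain (n - 1) (gen_face j s))"
      unfolding f by (rule linear_mapD(3)[OF D])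
    also have "\<dots> = (- 1) ^ j \<odot>\<^bsub>?C2\<^esub> ?L (\<Sum>i\<le>n - 1. Poly_Mapping.single (gen_face i (gen_face j s)) ((- 1) ^ i))"
      using differential_gen_chain[OF g1[OF j] n'(2)] n'(3) by simp
    also have "\<dots> = ?L (Poly_Mapping.map ((*) ((- 1) ^ j)) (\<Sum>i\<le>n - 1. Poly_Mapping.single (gen_face i (gen_face j s)) ((- 1) ^ i)))"
      using linear_mapD(3)[OF L] keys[OF j] by simp
    \<comment> \<open>The sign of the first face is absorbed into the formal sum of the second
      faces.\<close>
    also have "Poly_Mapping.map ((*) ((- 1) ^ j)) (\<Sum>i\<le>n - 1. Poly_Mapping.single (gen_face i (gen_face j s)) ((- 1) ^ i)) = ?P j"
      by (intro poly_mapping_eqI) (simp add: lookup_sum lookup_single sum_distrib_left power_add when_def if_distrib cong: if_cong)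
    finally show ?thesis .
  qed
  have face_closed: "face n j (gen_chain n s) \<in> carrier ?C1" if "j \<le> n" for j
    by (rule linear_mapD(1)[OF linear_face[OF n'(1) that]]) (use gen_chain_closed s in blast)
  have "differential (n - 1) (differential n (gen_chain n s))
      = (\<Oplus>\<^bsub>?C2\<^esub>j\<in>{0..n}. differential (n - 1) ((- 1) ^ j \<odot>\<^bsub>?C1\<^esub> face n j (gen_chain n s)))"
    unfolding differential_def[of n]
    by (intro linear_map_finsum[OF module_chains module_chains D]) (auto simp: face_closed simp del: One_nat_def)
  also have "\<dots> = (\<Oplus>\<^bsub>?C2\<^esub>j\<in>{..n}. ?L (?P j))"
  proof (rule C2.M.finsum_cong')
    have "?P j \<in> carrier (free_module (gens (n - 2)))" if "j \<le> n" for j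
      using keys[OF that] by simp
    then show "(\<lambda>j. ?L (?P j)) \<in> {..n} \<rightarrow> carrier ?C2"
      using linear_mapD(1)[OF L] by blast
  qed (simp only: atLeast0AtMost, rule step, simp)
  also have "\<dots> = ?L (\<Sum>j\<le>n. ?P j)"
    by (rule linear_map_sum_free_module[OF module_chains L, symmetric]) (use keys in auto)
  \<comment> \<open>Instantiated at \<open>n - 1\<close>, so that \<open>Suc (n - 1) = n\<close>
    bounds the first face and \<open>n - 1\<close> the second.\<close>
  also have "(\<Sum>j\<le>n. ?P j) = 0"
    using alternating_face_sum[of "n - 1" "\<lambda>j i. gen_face i (gen_face j s)"] gen_face_gen_face[OF s n] n
    by simp
  also have "?L 0 = \<zero>\<^bsub>?C2\<^esub>" using linear_map_zero[OF module_free_module module_chains L] by simp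
  finally show ?thesis .
qed

lemma differential_differential:
  assumes n: "2 \<le> n" and X: "X \<in> carrier (chains n)"
  shows "differential (n - 1) (differential n X) = \<zero>\<^bsub>chains (n - 2)\<^esub>"
proof (rule linear_map_eqI[OF module_chains module_chains _ _ _ _ X])
  have D: "linear_map (chains (n - 1)) (chains (n - 2)) (differential (n - 1))"
    using linear_differential[of "n - 1"] n by (simp add: numeral_2_eq_2)
  have "1 \<le> n" using n by simp
  from linear_map_comp[OF linear_differential[OF this] D]
  show "linear_map (chains n) (chains (n - 2)) (\<lambda>X. differential (n - 1) (differential n X))" .
  interpret C: module type_ring "chains (n - 2)" by (rule module_chains)
  show "linear_map (chains n) (chains (n - 2)) (\<lambda>X. \<zero>\<^bsub>chains (n - 2)\<^esub>)"
    by (simp add: linear_map_def C.smult_r_null[simplified])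
  show "generates (chains n) (gen_chain n ` gens n)"
    unfolding gen_chain_def gens_def by (rule generates_chains)
  fix Y assume "Y \<in> gen_chain n ` gens n"
  then obtain s where "Y = gen_chain n s" "s \<in> gens n" by (rule imageE)
  then show "differential (n - 1) (differential n Y) = \<zero>\<^bsub>chains (n - 2)\<^esub>"
    using differential_differential_gen_chain n by (simp only:)
qed

lemma chain_complex_chains: "chain_complex chains differential"
  unfolding chain_complex_def
  by (intro conjI allI impI ballI module_chains linear_differential differential_differential)

end

theorem corollary3p9:
  fixes scale :: "'k::field \<Rightarrow> 'a::ab_group_add \<Rightarrow> 'a"
    and lprod rprod mprod :: "'a \<Rightarrow> 'a \<Rightarrow> 'a"
    and act :: "'n::ab_group_add \<Rightarrow> ((copy \<Rightarrow> 'a) list \<Rightarrow>\<^sub>0 'k) set set \<Rightarrow> 'n"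
  assumes "triassociative_algebra scale lprod rprod mprod"
    and "right_module (triassociative_algebra.UA scale lprod rprod mprod) act"
  shows "chain_complex
    (trias_corepresentation.chains scale lprod rprod mprod act)
    (trias_corepresentation.differential scale lprod rprod mprod act)"
proof -
  interpret trias_corepresentation scale lprod rprod mprod act
    using assms by (rule trias_corepresentation.intro)
  show ?thesis by (rule chain_complex_chains)
qed

end
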